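(* Let $T$ be a completely non unitary contraction on a separable complex Hilbert space $\mathcal{H}$. Then the characteristic function $\Theta_T$ of $T$ is a polynomial if and only if there exist three closed subspaces $\mathcal{H}_1,\mathcal{H}_0,\mathcal{H}_{-1}$ of $\mathcal{H}$ (some possibly $\{0\}$) with $\mathcal{H}=\mathcal{H}_1\oplus\mathcal{H}_0\oplus\mathcal{H}_{-1}$, a pure isometry $S\in\mathcal{L}(\mathcal{H}_1)$, a nilpotent $N\in\mathcal{L}(\mathcal{H}_0)$ and a pure co-isometry $C\in\mathcal{L}(\mathcal{H}_{-1})$ such that $T$ has the matrix representation $$T=\begin{bmatrix}S&*&*\\0&N&*\\0&0&C\end{bmatrix}.$$ Moreover, in that case the degree of $\Theta_T$ is the smallest order of $N$ possible in such matrix representations of $T$.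
   Context: $\mathcal{L}(\mathcal{H})$ denotes the bounded linear operators on $\mathcal{H}$. A contraction $T$ ($\|T\|\le 1$) is completely non unitary if there is no nonzero $T$-reducing subspace on which $T$ is unitary. Put $D_T=(I-T^*T)^{1/2}$, $D_{T^*}=(I-TT^* )^{1/2}$, $\mathcal{D}_T=\overline{\mathrm{Ran}\,D_T}$, $\mathcal{D}_{T^*}=\overline{\mathrm{Ran}\,D_{T^*}}$. The characteristic function of $T$ is the $\mathcal{L}(\mathcal{D}_T,\mathcal{D}_{T^*})$-valued analytic function $\Theta_T(z)=[-T+zD_{T^*}(I-zT^* )^{-1}D_T]|_{\mathcal{D}_T}$, $z\in\mathbb{D}$; "polynomial" means operator-valued polynomial, and constant functions (including $0$) have degree $0$. Entries $*$ are unspecified. The order of a nilpotent operator $N$ is the smallest integer $p\ge0$ with $N^p=0$, where $N^0=I$ (order $0$ means the space is $\{0\}$). A pure isometry is an isometry with no unitary part, i.e. a unilateral shift of some multiplicity (possibly $0$); a pure co-isometry is an operator whose adjoint is a pure isometry. *)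

theory Defs
  imports "HOL-Analysis.Analysis"
begin

section \<open>Complex Hilbert spaces\<close>

text \<open>The inner product is linear in the first argument. Its real part is the real inner product
  of the library, so norm and topology are the ones inherited from \<^class>\<open>real_inner\<close>;
  positive definiteness of the complex inner product follows from the axioms of that class.\<close>

class complex_inner = real_inner +
  fixes scaleC :: "complex \<Rightarrow> 'a \<Rightarrow> 'a" (infixr \<open>*\<^sub>C\<close> 75)
    and cinner :: "'a \<Rightarrow> 'a \<Rightarrow> complex"
  assumes scaleC_add_right: "c *\<^sub>C (x + y) = c *\<^sub>C x + c *\<^sub>C y"
    and scaleC_add_left: "(c + d) *\<^sub>C x = c *\<^sub>C x + d *\<^sub>C x"
    and scaleC_scaleC: "c *\<^sub>C d *\<^sub>C x = (c * d) *\<^sub>C x"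
    and scaleC_of_real: "of_real r *\<^sub>C x = r *\<^sub>R x"
    and cinner_commute: "cinner x y = cnj (cinner y x)"
    and cinner_add_left: "cinner (x + y) z = cinner x z + cinner y z"
    and cinner_scaleC_left: "cinner (c *\<^sub>C x) y = c * cinner x y"
    and Re_cinner: "Re (cinner x y) = inner x y"

class complex_hilbert = complex_inner + complete_space

definition closed_csubspace :: "'a::complex_hilbert set \<Rightarrow> bool" where
  "closed_csubspace M \<longleftrightarrow> subspace M \<and> (\<forall>c. \<forall>x\<in>M. c *\<^sub>C x \<in> M) \<and> closed M"

section \<open>Operators between closed subspaces\<close>

text \<open>Bounded complex-linear operators from \<open>M\<close> to \<open>K\<close> are represented by functions on the whole
  type whose values outside \<open>M\<close> are irrelevant; all notions below only look at the values on the
  domain.\<close>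

definition bounded_ops :: "'a::complex_hilbert set \<Rightarrow> 'a set \<Rightarrow> ('a \<Rightarrow> 'a) set" where
  "bounded_ops M K = {A.
     (\<forall>x\<in>M. A x \<in> K) \<and>
     (\<forall>x\<in>M. \<forall>y\<in>M. A (x + y) = A x + A y) \<and>
     (\<forall>c. \<forall>x\<in>M. A (c *\<^sub>C x) = c *\<^sub>C A x) \<and>
     (\<exists>B. \<forall>x\<in>M. norm (A x) \<le> B * norm x)}"

text \<open>The Hilbert space adjoint of an operator with domain \<open>M\<close>; its values lie in \<open>M\<close>.\<close>

definition adj_on :: "'a::complex_hilbert set \<Rightarrow> ('a \<Rightarrow> 'a) \<Rightarrow> 'a \<Rightarrow> 'a" where
  "adj_on M A y = (THE x. x \<in> M \<and> (\<forall>u\<in>M. cinner (A u) y = cinner u x))"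

abbreviation adj :: "('a::complex_hilbert \<Rightarrow> 'a) \<Rightarrow> 'a \<Rightarrow> 'a" where
  "adj \<equiv> adj_on UNIV"

definition isometry_on :: "'a::complex_hilbert set \<Rightarrow> ('a \<Rightarrow> 'a) \<Rightarrow> bool" where
  "isometry_on M V \<longleftrightarrow> V \<in> bounded_ops M M \<and> (\<forall>x\<in>M. norm (V x) = norm x)"

definition unitary_on :: "'a::complex_hilbert set \<Rightarrow> ('a \<Rightarrow> 'a) \<Rightarrow> bool" where
  "unitary_on M U \<longleftrightarrow> isometry_on M U \<and> U ` M = M"

definition reducing_subspace :: "'a::complex_hilbert set \<Rightarrow> ('a \<Rightarrow> 'a) \<Rightarrow> 'a set \<Rightarrow> bool" where
  "reducing_subspace M A K \<longleftrightarrow> closed_csubspace K \<and> K \<subseteq> M \<and>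
     (\<forall>x\<in>K. A x \<in> K) \<and> (\<forall>x\<in>K. adj_on M A x \<in> K)"

definition completely_nonunitary_on :: "'a::complex_hilbert set \<Rightarrow> ('a \<Rightarrow> 'a) \<Rightarrow> bool" where
  "completely_nonunitary_on M A \<longleftrightarrow>
     \<not> (\<exists>K. K \<noteq> {0} \<and> reducing_subspace M A K \<and> unitary_on K A)"

definition contraction :: "('a::complex_hilbert \<Rightarrow> 'a) \<Rightarrow> bool" where
  "contraction T \<longleftrightarrow> T \<in> bounded_ops UNIV UNIV \<and> onorm T \<le> 1"

definition pure_isometry_on :: "'a::complex_hilbert set \<Rightarrow> ('a \<Rightarrow> 'a) \<Rightarrow> bool" where
  "pure_isometry_on M S \<longleftrightarrow> isometry_on M S \<and> completely_nonunitary_on M S"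

definition pure_coisometry_on :: "'a::complex_hilbert set \<Rightarrow> ('a \<Rightarrow> 'a) \<Rightarrow> bool" where
  "pure_coisometry_on M C \<longleftrightarrow> C \<in> bounded_ops M M \<and> pure_isometry_on M (adj_on M C)"

definition nilpotent_on :: "'a::complex_hilbert set \<Rightarrow> ('a \<Rightarrow> 'a) \<Rightarrow> bool" where
  "nilpotent_on M N \<longleftrightarrow> N \<in> bounded_ops M M \<and> (\<exists>p. \<forall>x\<in>M. (N ^^ p) x = 0)"

definition nilpotency_order :: "'a::complex_hilbert set \<Rightarrow> ('a \<Rightarrow> 'a) \<Rightarrow> nat" where
  "nilpotency_order M N = (LEAST p. \<forall>x\<in>M. (N ^^ p) x = 0)"

section \<open>Defect operators and the characteristic function\<close>

definition positive_op :: "('a::complex_hilbert \<Rightarrow> 'a) \<Rightarrow> bool" where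
  "positive_op R \<longleftrightarrow> R \<in> bounded_ops UNIV UNIV \<and> (\<forall>x. cinner (R x) x \<in> \<real>\<^sub>\<ge>\<^sub>0)"

definition sqrt_op :: "('a::complex_hilbert \<Rightarrow> 'a) \<Rightarrow> 'a \<Rightarrow> 'a" where
  "sqrt_op A = (THE R. positive_op R \<and> R \<circ> R = A)"

definition defect_op :: "('a::complex_hilbert \<Rightarrow> 'a) \<Rightarrow> 'a \<Rightarrow> 'a" where
  "defect_op T = sqrt_op (\<lambda>x. x - adj T (T x))"

definition defect_space :: "('a::complex_hilbert \<Rightarrow> 'a) \<Rightarrow> 'a set" where
  "defect_space T = closure (range (defect_op T))"

text \<open>The defect operator of \<open>adj T\<close> is the positive square root of \<open>I - T T\<^sup>*\<close>, because the
  adjoint of \<open>adj T\<close> is \<open>T\<close>. The characteristic function at \<open>z\<close> is only meant to be applied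
  to vectors of \<^term>\<open>defect_space T\<close>, for \<open>z\<close> in the open unit disc.\<close>

definition characteristic_function ::
    "('a::complex_hilbert \<Rightarrow> 'a) \<Rightarrow> complex \<Rightarrow> 'a \<Rightarrow> 'a" where
  "characteristic_function T z x =
     - T x + z *\<^sub>C defect_op (adj T) (inv (\<lambda>y. y - z *\<^sub>C adj T y) (defect_op T x))"

section \<open>Operator-valued polynomials on the unit disc\<close>

text \<open>\<open>F\<close> is, on the open unit disc, a polynomial of degree \<open>n\<close> with coefficients in the bounded
  operators from \<open>M\<close> to \<open>K\<close>. Constants have degree \<open>0\<close>, including the zero function.\<close>

definition operator_poly_of_degree ::
    "'a::complex_hilbert set \<Rightarrow> 'a set \<Rightarrow> (complex \<Rightarrow> 'a \<Rightarrow> 'a) \<Rightarrow> nat \<Rightarrow> bool" where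
  "operator_poly_of_degree M K F n \<longleftrightarrow> (\<exists>A :: nat \<Rightarrow> 'a \<Rightarrow> 'a.
     (\<forall>k\<le>n. A k \<in> bounded_ops M K) \<and>
     (n = 0 \<or> (\<exists>x\<in>M. A n x \<noteq> 0)) \<and>
     (\<forall>z\<in>ball 0 1. \<forall>x\<in>M. F z x = (\<Sum>k\<le>n. z ^ k *\<^sub>C A k x)))"

definition operator_polynomial ::
    "'a::complex_hilbert set \<Rightarrow> 'a set \<Rightarrow> (complex \<Rightarrow> 'a \<Rightarrow> 'a) \<Rightarrow> bool" where
  "operator_polynomial M K F \<longleftrightarrow> (\<exists>n. operator_poly_of_degree M K F n)"

definition operator_degree ::
    "'a::complex_hilbert set \<Rightarrow> 'a set \<Rightarrow> (complex \<Rightarrow> 'a \<Rightarrow> 'a) \<Rightarrow> nat" where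
  "operator_degree M K F = (THE n. operator_poly_of_degree M K F n)"

section \<open>Triangular matrix representations\<close>

definition orthogonal_decomposition ::
    "'a::complex_hilbert set \<Rightarrow> 'a set \<Rightarrow> 'a set \<Rightarrow> bool" where
  "orthogonal_decomposition H1 H0 Hm \<longleftrightarrow>
     closed_csubspace H1 \<and> closed_csubspace H0 \<and> closed_csubspace Hm \<and>
     (\<forall>x\<in>H1. \<forall>y\<in>H0. cinner x y = 0) \<and>
     (\<forall>x\<in>H1. \<forall>y\<in>Hm. cinner x y = 0) \<and>
     (\<forall>x\<in>H0. \<forall>y\<in>Hm. cinner x y = 0) \<and>
     (\<forall>x. \<exists>a\<in>H1. \<exists>b\<in>H0. \<exists>c\<in>Hm. x = a + b + c)"

text \<open>\<open>X\<close>, \<open>Y\<close>, \<open>Z\<close> are the unspecified entries of the block matrix with rows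
  \<open>(S, X, Y)\<close>, \<open>(0, N, Z)\<close> and \<open>(0, 0, C)\<close>.\<close>

definition upper_triangular_rep ::
    "('a::complex_hilbert \<Rightarrow> 'a) \<Rightarrow> 'a set \<Rightarrow> 'a set \<Rightarrow> 'a set \<Rightarrow>
     ('a \<Rightarrow> 'a) \<Rightarrow> ('a \<Rightarrow> 'a) \<Rightarrow> ('a \<Rightarrow> 'a) \<Rightarrow> bool" where
  "upper_triangular_rep T H1 H0 Hm S N C \<longleftrightarrow>
     (\<exists>X\<in>bounded_ops H0 H1. \<exists>Y\<in>bounded_ops Hm H1. \<exists>Z\<in>bounded_ops Hm H0.
        \<forall>a\<in>H1. \<forall>b\<in>H0. \<forall>c\<in>Hm.
          T (a + b + c) = (S a + X b + Y c) + (N b + Z c) + C c)"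

definition shift_nilpotent_coshift_rep ::
    "('a::complex_hilbert \<Rightarrow> 'a) \<Rightarrow> 'a set \<Rightarrow> 'a set \<Rightarrow> 'a set \<Rightarrow>
     ('a \<Rightarrow> 'a) \<Rightarrow> ('a \<Rightarrow> 'a) \<Rightarrow> ('a \<Rightarrow> 'a) \<Rightarrow> bool" where
  "shift_nilpotent_coshift_rep T H1 H0 Hm S N C \<longleftrightarrow>
     orthogonal_decomposition H1 H0 Hm \<and>
     pure_isometry_on H1 S \<and> nilpotent_on H0 N \<and> pure_coisometry_on Hm C \<and>
     upper_triangular_rep T H1 H0 Hm S N C"

end

theory Submission
  imports Defs
begin

text \<open>Write \<open>A = I - T\<^sup>*T\<close> and \<open>A\<^sub>* = I - TT\<^sup>*\<close> for the squares of the two defect operators.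
  Expanding the resolvent in a Neumann series, the Taylor coefficients of \<open>\<Theta>\<^sub>T\<close> are \<open>-T\<close> and
  \<open>D\<^sub>*T\<^sup>*\<^sup>kD\<close> for \<open>k \<ge> 0\<close>. Since \<open>D\<close> and \<open>A\<close> have the same kernel, as have \<open>D\<^sub>*\<close> and \<open>A\<^sub>*\<close>, the
  coefficients of index larger than \<open>n\<close> all vanish iff \<open>A T\<^sup>k A\<^sub>* = 0\<close> for all \<open>k \<ge> n\<close>
  (\<open>theta_coeff_eq_0_iff\<close>). This condition, called \<open>theta_vanishes_from T n\<close> below, is what is
  compared with triangular representations.

  Suppose that it holds. The subspaces \<open>L\<^sub>j = {x. A T\<^sup>k x = 0 for all k \<ge> j}\<close> are invariant under \<open>T\<close> and
  increase with \<open>j\<close>, and \<open>T\<^sup>n\<close> maps \<open>L\<^sub>n\<close> into \<open>L\<^sub>0\<close>. Take \<open>H\<^sub>1 = L\<^sub>0\<close>, \<open>H\<^sub>0 = L\<^sub>n \<ominus> L\<^sub>0\<close> and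
  \<open>H\<^sub>-\<^sub>1 = L\<^sub>n\<^sup>\<bottom>\<close>. By invariance \<open>T\<close> is triangular. It is isometric on \<open>H\<^sub>1\<close>, and its compression to \<open>H\<^sub>0\<close>
  has vanishing \<open>n\<close>-th power. The hypothesis says that the range of \<open>A\<^sub>*\<close> lies in \<open>L\<^sub>n\<close>, so
  the self-adjoint \<open>A\<^sub>*\<close> vanishes on \<open>H\<^sub>-\<^sub>1\<close>, that is, \<open>T\<^sup>*\<close> is isometric there. Both isometries are pure because a
  subspace that \<open>T\<close> or \<open>T\<^sup>*\<close> maps isometrically onto itself reduces \<open>T\<close> to a unitary operator
  (\<open>rep_if_theta_vanishes\<close>).

  Conversely, given a representation with \<open>N\<^sup>p = 0\<close>, the operator \<open>A\<^sub>*\<close> kills \<open>H\<^sub>-\<^sub>1\<close>, hence has range in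
  \<open>H\<^sub>1 \<oplus> H\<^sub>0\<close>; for \<open>k \<ge> p\<close> this is mapped into \<open>H\<^sub>1\<close> by \<open>T\<^sup>k\<close>, and there \<open>A\<close> vanishes
  (\<open>theta_vanishes_if_rep\<close>). Thus the degree is at most the order of \<open>N\<close> in every
  representation, and the representation built from a \<open>\<Theta>\<^sub>T\<close> of degree \<open>n\<close> has order at most \<open>n\<close>.

  That \<open>D\<close> is determined by \<open>D \<ge> 0\<close> and \<open>D\<^sup>2 = I - T\<^sup>*T\<close> is a fact about the self-adjoint
  contraction \<open>B = T\<^sup>*T\<close>. A root of \<open>I - B\<close> is \<open>I - Y\<close> with \<open>Y\<close> the limit of the iteration of
  \<open>Y \<mapsto> (B + Y\<^sup>2) / 2\<close> from \<open>0\<close>; another positive root commutes with \<open>B\<close>, hence with \<open>Y\<close>, and two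
  commuting positive roots of the same operator coincide.\<close>

section \<open>Complex inner products\<close>

lemma cinner_zero_left [simp]: "cinner 0 (y :: 'a::complex_inner) = 0"
  using cinner_add_left[of 0 0 y] by simp

lemma cinner_minus_left: "cinner (- x) (y :: 'a::complex_inner) = - cinner x y"
  using cinner_add_left[of x "- x" y] by (simp add: add_eq_0_iff)

lemma cinner_diff_left: "cinner (x - y) (z :: 'a::complex_inner) = cinner x z - cinner y z"
  using cinner_add_left[of x "- y" z] by (simp add: cinner_minus_left)

lemma cinner_add_right: "cinner x (y + z :: 'a::complex_inner) = cinner x y + cinner x z"
  by (metis cinner_add_left cinner_commute complex_cnj_add)

lemma cinner_zero_right [simp]: "cinner x (0 :: 'a::complex_inner) = 0"
  using cinner_add_right[of x 0 0] by simp

lemma cinner_minus_right: "cinner x (- y :: 'a::complex_inner) = - cinner x y"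
  using cinner_add_right[of x y "- y"] by (simp add: add_eq_0_iff)

lemma cinner_diff_right: "cinner x (y - z :: 'a::complex_inner) = cinner x y - cinner x z"
  using cinner_add_right[of x y "- z"] by (simp add: cinner_minus_right)

lemma cinner_scaleC_right: "cinner x (c *\<^sub>C y :: 'a::complex_inner) = cnj c * cinner x y"
  by (metis cinner_commute cinner_scaleC_left complex_cnj_mult complex_cnj_cnj)

lemma cinner_scaleR_left: "cinner (r *\<^sub>R x) (y :: 'a::complex_inner) = of_real r * cinner x y"
  by (metis cinner_scaleC_left scaleC_of_real)

lemma cinner_scaleR_right: "cinner x (r *\<^sub>R y :: 'a::complex_inner) = of_real r * cinner x y"
  by (metis cinner_scaleC_right scaleC_of_real complex_cnj_complex_of_real)

lemma cinner_self: "cinner x (x :: 'a::complex_inner) = of_real ((norm x)\<^sup>2)"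
proof -
  have "Im (cinner x x) = 0"
    using cinner_commute[of x x] by (metis Reals_cnj_iff complex_is_Real_iff)
  moreover have "Re (cinner x x) = (norm x)\<^sup>2"
    by (simp add: Re_cinner power2_norm_eq_inner)
  ultimately show ?thesis by (simp add: complex_eq_iff)
qed

lemma cinner_self_eq_0_iff [simp]: "cinner x x = 0 \<longleftrightarrow> x = (0 :: 'a::complex_inner)"
  by (simp add: cinner_self)

lemma cinner_commute_0: "cinner x (y :: 'a::complex_inner) = 0 \<longleftrightarrow> cinner y x = 0"
  by (metis cinner_commute complex_cnj_zero_iff)

lemma cinner_ext: "(\<And>w. cinner x w = cinner (y :: 'a::complex_inner) w) \<Longrightarrow> x = y"
  by (metis cinner_diff_left cinner_self_eq_0_iff right_minus_eq)

lemma scaleC_zero_right [simp]: "c *\<^sub>C (0 :: 'a::complex_inner) = 0"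
  using scaleC_add_right[of c 0 "0::'a"] by simp

lemma scaleC_one [simp]: "1 *\<^sub>C (x :: 'a::complex_inner) = x"
  using scaleC_of_real[of 1 x] by simp

lemma scaleC_minus_right: "c *\<^sub>C (- x) = - (c *\<^sub>C (x :: 'a::complex_inner))"
  using scaleC_add_right[of c x "- x"] by (simp add: add_eq_0_iff)

lemma scaleC_diff_right: "c *\<^sub>C (x - y) = c *\<^sub>C x - c *\<^sub>C (y :: 'a::complex_inner)"
  using scaleC_add_right[of c x "- y"] by (simp add: scaleC_minus_right)

lemma scaleC_scaleR: "c *\<^sub>C (r *\<^sub>R x) = r *\<^sub>R (c *\<^sub>C (x :: 'a::complex_inner))"
  by (metis scaleC_of_real scaleC_scaleC mult.commute)

lemma norm_scaleC: "norm (c *\<^sub>C x) = cmod c * norm (x :: 'a::complex_inner)"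
proof -
  have "cinner (c *\<^sub>C x) (c *\<^sub>C x) = c * cnj c * cinner x x"
    by (simp add: cinner_scaleC_left cinner_scaleC_right)
  then have "complex_of_real ((norm (c *\<^sub>C x))\<^sup>2) = of_real ((cmod c * norm x)\<^sup>2)"
    by (simp only: cinner_self power_mult_distrib of_real_mult complex_norm_square)
  then have "(norm (c *\<^sub>C x))\<^sup>2 = (cmod c * norm x)\<^sup>2" by (simp only: of_real_eq_iff)
  then show ?thesis by simp
qed

lemma norm_cinner_le: "cmod (cinner x y) \<le> norm x * norm (y :: 'a::complex_inner)"
proof (cases "cinner x y = 0")
  case False
  \<comment> \<open>Rotating \<open>x\<close> by a unimodular factor makes the inner product real, where the real
    Cauchy-Schwarz inequality applies.\<close>
  define c where "c = cnj (cinner x y) / cmod (cinner x y)"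
  have c: "cmod c = 1" using False by (simp add: c_def norm_divide)
  have "c * cinner x y = of_real (cmod (cinner x y))"
    using False by (simp add: c_def complex_norm_square[symmetric] power2_eq_square mult.commute
        divide_simps)
  then have "cmod (cinner x y) = inner (c *\<^sub>C x) y"
    by (metis Re_cinner cinner_scaleC_left Re_complex_of_real)
  also have "\<dots> \<le> norm (c *\<^sub>C x) * norm y" by (rule norm_cauchy_schwarz)
  finally show ?thesis by (simp add: norm_scaleC c)
qed simp

lemma bounded_linear_cinner_left: "bounded_linear (\<lambda>x. cinner x (y :: 'a::complex_inner))"
  by (rule bounded_linear_intro[where K = "norm y"])
     (auto simp: cinner_add_left cinner_scaleR_left scaleR_conv_of_real norm_cinner_le)

lemma bounded_linear_cinner_right: "bounded_linear (\<lambda>y. cinner (x :: 'a::complex_inner) y)"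
  by (rule bounded_linear_intro[where K = "norm x"])
     (auto simp: cinner_add_right cinner_scaleR_right scaleR_conv_of_real mult.commute
       intro: order_trans[OF norm_cinner_le])

lemma bounded_linear_scaleC: "bounded_linear (\<lambda>x :: 'a::complex_inner. c *\<^sub>C x)"
  by (rule bounded_linear_intro[where K = "cmod c"])
     (auto simp: scaleC_add_right scaleC_scaleR norm_scaleC mult.commute)

section \<open>Orthogonal projections\<close>

definition orth :: "'a::complex_hilbert set \<Rightarrow> 'a set" where
  "orth M = {x. \<forall>y\<in>M. cinner x y = 0}"

lemma closed_csubspaceD:
  assumes "closed_csubspace M"
  shows "0 \<in> M" "x \<in> M \<Longrightarrow> y \<in> M \<Longrightarrow> x + y \<in> M" "x \<in> M \<Longrightarrow> y \<in> M \<Longrightarrow> x - y \<in> M"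
    "x \<in> M \<Longrightarrow> c *\<^sub>C x \<in> M" "x \<in> M \<Longrightarrow> r *\<^sub>R x \<in> M" "x \<in> M \<Longrightarrow> - x \<in> M" "closed M" "subspace M"
  using assms unfolding closed_csubspace_def
  by (auto intro: subspace_0 subspace_add subspace_diff subspace_scale subspace_neg)

lemma closed_csubspaceI:
  assumes "0 \<in> M" "\<And>x y. x \<in> M \<Longrightarrow> y \<in> M \<Longrightarrow> x + y \<in> M"
    "\<And>c x. x \<in> M \<Longrightarrow> c *\<^sub>C x \<in> M" "closed M"
  shows "closed_csubspace M"
  using assms unfolding closed_csubspace_def subspace_def by (metis scaleC_of_real)

lemma closed_csubspace_UNIV [simp]: "closed_csubspace UNIV"
  by (simp add: closed_csubspace_def)

lemma closed_csubspace_Int: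
  "closed_csubspace M \<Longrightarrow> closed_csubspace K \<Longrightarrow> closed_csubspace (M \<inter> K)"
  by (auto simp: closed_csubspace_def subspace_inter)

lemma orthD: "x \<in> orth M \<Longrightarrow> y \<in> M \<Longrightarrow> cinner x y = 0"
  "x \<in> orth M \<Longrightarrow> y \<in> M \<Longrightarrow> cinner y x = 0"
  by (auto simp: orth_def cinner_commute_0)

lemma closed_csubspace_orth: "closed_csubspace (orth M)"
proof (rule closed_csubspaceI)
  have "orth M = (\<Inter>y\<in>M. (\<lambda>x. cinner x y) -` {0})" by (auto simp: orth_def)
  moreover have "closed ((\<lambda>x. cinner x y) -` {0})" for y :: 'a
    by (intro closed_vimage bounded_linear.continuous_on[OF bounded_linear_cinner_left]
        continuous_intros)
  ultimately show "closed (orth M)" by auto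
qed (auto simp: orth_def cinner_add_left cinner_scaleC_left)

lemma orth_Int_eq_0: "x \<in> M \<Longrightarrow> x \<in> orth M \<Longrightarrow> x = 0"
  using orthD(1) cinner_self_eq_0_iff by blast

text \<open>A minimising sequence for the distance from \<open>x\<close> to \<open>M\<close> is Cauchy by the parallelogram
  law, applied to \<open>x - s\<^sub>m\<close> and \<open>x - s\<^sub>n\<close> with the midpoint of \<open>s\<^sub>m\<close> and \<open>s\<^sub>n\<close> again in \<open>M\<close>; its
  limit is nearest to \<open>x\<close>.\<close>

lemma nearest_point_exists:
  fixes M :: "'a::complex_hilbert set"
  assumes "subspace M" "closed M"
  obtains m where "m \<in> M" "\<And>y. y \<in> M \<Longrightarrow> norm (x - m) \<le> norm (x - y)"
proof -
  define d where "d = (INF y\<in>M. (norm (x - y))\<^sup>2)"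
  have M0: "0 \<in> M" using assms(1) by (rule subspace_0)
  have bdd: "bdd_below ((\<lambda>y. (norm (x - y))\<^sup>2) ` M)" by (rule bdd_belowI[of _ 0]) auto
  have d_le: "d \<le> (norm (x - y))\<^sup>2" if "y \<in> M" for y
    unfolding d_def using bdd that by (rule cINF_lower)
  have "\<exists>y\<in>M. (norm (x - y))\<^sup>2 < d + 1 / Suc n" for n
    using cINF_less_iff[OF _ bdd, of "d + 1 / Suc n"] M0 unfolding d_def by fastforce
  then obtain s where s: "\<And>n. s n \<in> M" "\<And>n. (norm (x - s n))\<^sup>2 < d + 1 / Suc n" by metis
  have key: "(norm (s m - s n))\<^sup>2 \<le> 2 / Suc m + 2 / Suc n" for m n
  proof -
    have "(1/2) *\<^sub>R (s m + s n) \<in> M" using s(1) assms(1) by (simp add: subspace_add subspace_scale)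
    then have "d \<le> (norm (x - (1/2) *\<^sub>R (s m + s n)))\<^sup>2" by (rule d_le)
    moreover have "(norm (s m - s n))\<^sup>2 = 2 * (norm (x - s m))\<^sup>2 + 2 * (norm (x - s n))\<^sup>2
        - 4 * (norm (x - (1/2) *\<^sub>R (s m + s n)))\<^sup>2"
      unfolding power2_norm_eq_inner
      by (simp add: inner_diff_left inner_diff_right inner_add_left inner_add_right inner_commute
          algebra_simps)
    moreover have "2 / Suc m = 2 * (1 / Suc m)" "2 / Suc n = 2 * (1 / Suc n)" by simp_all
    ultimately show ?thesis using s(2)[of m] s(2)[of n] by linarith
  qed
  have "Cauchy s"
  proof (rule metric_CauchyI)
    fix e :: real assume e: "e > 0"
    then obtain K where K: "1 / Suc K < e\<^sup>2 / 4"
      using nat_approx_posE[of "e\<^sup>2 / 4"] by (metis zero_less_divide_iff zero_less_numeral zero_less_power)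
    have "dist (s m) (s n) < e" if "m \<ge> K" "n \<ge> K" for m n
    proof -
      have "1 / Suc m \<le> 1 / Suc K" "1 / Suc n \<le> 1 / Suc K" using that by (auto simp: field_simps)
      then have "(norm (s m - s n))\<^sup>2 < e\<^sup>2" using key[of m n] K by linarith
      then show ?thesis using e by (simp add: dist_norm power_less_imp_less_base)
    qed
    then show "\<exists>K. \<forall>m\<ge>K. \<forall>n\<ge>K. dist (s m) (s n) < e" by blast
  qed
  then obtain m where m: "s \<longlonglongrightarrow> m" using Cauchy_convergent convergent_def by blast
  have "m \<in> M" using closed_sequentially[OF assms(2)] s(1) m by blast
  moreover have "norm (x - m) \<le> norm (x - y)" if "y \<in> M" for y
  proof -
    have "(\<lambda>n. (norm (x - s n))\<^sup>2) \<longlonglongrightarrow> (norm (x - m))\<^sup>2" by (intro tendsto_intros m)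
    moreover have "(\<lambda>n. d + 1 / Suc n) \<longlonglongrightarrow> d + 0"
      by (intro tendsto_intros LIMSEQ_Suc[OF lim_1_over_n])
    ultimately have "(norm (x - m))\<^sup>2 \<le> d + 0"
      using s(2) by (intro LIMSEQ_le) (auto intro: less_imp_le)
    then have "(norm (x - m))\<^sup>2 \<le> (norm (x - y))\<^sup>2" using d_le[OF that] by linarith
    then show ?thesis by simp
  qed
  ultimately show ?thesis using that by blast
qed

text \<open>If \<open>m\<close> is nearest to \<open>x\<close>, then moving \<open>m\<close> along a vector \<open>y\<close> of \<open>M\<close> cannot decrease the
  distance, which forces the real inner product of \<open>x - m\<close> and \<open>y\<close> to vanish; the imaginary
  part is the same statement for \<open>\<i> y\<close>.\<close>

lemma orthogonal_split:
  assumes "closed_csubspace M"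
  obtains m where "m \<in> M" "x - m \<in> orth M"
proof -
  note M = closed_csubspaceD[OF assms]
  obtain m where m: "m \<in> M" "\<And>y. y \<in> M \<Longrightarrow> norm (x - m) \<le> norm (x - y)"
    using nearest_point_exists[OF M(8,7)] by metis
  have re: "inner (x - m) y = 0" if "y \<in> M" for y
  proof (cases "y = 0")
    case False
    \<comment> \<open>The minimiser of the quadratic \<open>t \<mapsto> \<parallel>x - m - t y\<parallel>\<^sup>2\<close>.\<close>
    define t where "t = inner (x - m) y / (norm y)\<^sup>2"
    have "norm (x - m) \<le> norm (x - (m + t *\<^sub>R y))" using m(1) that by (intro m(2) M)
    then have "(norm (x - m))\<^sup>2 \<le> (norm ((x - m) - t *\<^sub>R y))\<^sup>2"
      by (simp add: diff_diff_eq power_mono)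
    also have "\<dots> = (norm (x - m))\<^sup>2 - 2 * t * inner (x - m) y + t\<^sup>2 * (norm y)\<^sup>2"
      unfolding power2_norm_eq_inner
      by (simp only: inner_diff_left[of "x - m"] inner_diff_right[of _ "x - m"])
         (simp add: inner_commute power2_eq_square algebra_simps)
    also have "\<dots> = (norm (x - m))\<^sup>2 - (inner (x - m) y)\<^sup>2 / (norm y)\<^sup>2"
      using False by (simp add: t_def power2_eq_square field_simps)
    finally have "(inner (x - m) y)\<^sup>2 / (norm y)\<^sup>2 \<le> 0" by simp
    then show ?thesis using False by (simp add: divide_le_0_iff)
  qed simp
  have "cinner (x - m) y = 0" if "y \<in> M" for y
  proof -
    have "Re (cinner (x - m) (\<i> *\<^sub>C y)) = 0" using re[OF M(4)[OF that]] by (simp add: Re_cinner)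
    then show ?thesis using re[OF that] by (simp add: cinner_scaleC_right complex_eq_iff Re_cinner)
  qed
  then show ?thesis using that m(1) by (auto simp: orth_def)
qed

lemma orth_orth:
  assumes "closed_csubspace M"
  shows "orth (orth M) = M"
proof
  show "orth (orth M) \<subseteq> M"
  proof
    fix x assume x: "x \<in> orth (orth M)"
    obtain m where m: "m \<in> M" "x - m \<in> orth M" by (rule orthogonal_split[OF assms])
    have "m \<in> orth (orth M)" using m(1) by (auto simp: orth_def cinner_commute_0)
    then have "x - m \<in> orth (orth M)"
      using x closed_csubspaceD(3)[OF closed_csubspace_orth] by blast
    then have "x - m = 0" using m(2) orth_Int_eq_0 by blast
    then show "x \<in> M" using m(1) by simp
  qed
qed (auto simp: orth_def cinner_commute_0)

definition proj :: "'a::complex_hilbert set \<Rightarrow> 'a \<Rightarrow> 'a" where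
  "proj M x = (SOME m. m \<in> M \<and> x - m \<in> orth M)"

lemma proj_in: "closed_csubspace M \<Longrightarrow> proj M x \<in> M"
  and proj_orth: "closed_csubspace M \<Longrightarrow> x - proj M x \<in> orth M"
  using someI_ex[of "\<lambda>m. m \<in> M \<and> x - m \<in> orth M"] orthogonal_split[of M x]
  unfolding proj_def by blast+

lemma proj_eqI:
  assumes "closed_csubspace M" "m \<in> M" "x - m \<in> orth M"
  shows "proj M x = m"
proof -
  have "proj M x - m \<in> M" using assms proj_in closed_csubspaceD(3) by blast
  moreover have "(x - m) - (x - proj M x) \<in> orth M"
    using assms proj_orth closed_csubspaceD(3)[OF closed_csubspace_orth] by blast
  ultimately show ?thesis using orth_Int_eq_0[of "proj M x - m"] by simp
qed

lemma cinner_proj_left: "closed_csubspace M \<Longrightarrow> y \<in> M \<Longrightarrow> cinner (proj M x) y = cinner x y"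
  using orthD(1)[OF proj_orth] by (metis cinner_diff_left eq_iff_diff_eq_0)

lemma norm_proj_le:
  assumes "closed_csubspace M"
  shows "norm (proj M x) \<le> norm x"
proof -
  have "of_real ((norm (proj M x))\<^sup>2) = cinner x (proj M x)"
    using cinner_proj_left[OF assms proj_in[OF assms], of x x] by (simp add: cinner_self)
  then have "(norm (proj M x))\<^sup>2 \<le> norm x * norm (proj M x)"
    using norm_cinner_le[of x "proj M x"] by (metis abs_of_nonneg norm_of_real zero_le_power2)
  then show ?thesis by (metis mult_le_cancel_right norm_ge_zero order_trans power2_eq_square linorder_not_le)
qed

lemma bounded_opsD:
  assumes "A \<in> bounded_ops M K"
  shows "x \<in> M \<Longrightarrow> A x \<in> K" "x \<in> M \<Longrightarrow> y \<in> M \<Longrightarrow> A (x + y) = A x + A y"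
    "x \<in> M \<Longrightarrow> A (c *\<^sub>C x) = c *\<^sub>C A x"
  using assms by (auto simp: bounded_ops_def)

lemma bounded_opsI:
  assumes "\<And>x. x \<in> M \<Longrightarrow> A x \<in> K" "\<And>x y. x \<in> M \<Longrightarrow> y \<in> M \<Longrightarrow> A (x + y) = A x + A y"
    "\<And>c x. x \<in> M \<Longrightarrow> A (c *\<^sub>C x) = c *\<^sub>C A x" "\<And>x. x \<in> M \<Longrightarrow> norm (A x) \<le> B * norm x"
  shows "A \<in> bounded_ops M K"
  using assms unfolding bounded_ops_def by blast

lemma bounded_ops_bounded_linear:
  assumes "A \<in> bounded_ops UNIV K"
  shows "bounded_linear A"
proof -
  obtain B where "\<forall>x. norm (A x) \<le> B * norm x" using assms by (auto simp: bounded_ops_def)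
  then show ?thesis using bounded_opsD(2,3)[OF assms]
    by (intro bounded_linear_intro[where K = B]) (auto simp: mult.commute simp flip: scaleC_of_real)
qed

lemma proj_bounded_op:
  assumes "closed_csubspace M"
  shows "proj M \<in> bounded_ops UNIV M"
proof (rule bounded_opsI[where B = 1])
  note M = closed_csubspaceD[OF assms] and O = closed_csubspaceD[OF closed_csubspace_orth[of M]]
  note p = proj_in[OF assms] proj_orth[OF assms]
  show "proj M (x + y) = proj M x + proj M y" for x y
  proof (rule proj_eqI[OF assms])
    show "x + y - (proj M x + proj M y) \<in> orth M"
      using O(2)[OF p(2)[of x] p(2)[of y]] by (simp add: algebra_simps)
  qed (intro M p)
  show "proj M (c *\<^sub>C x) = c *\<^sub>C proj M x" for c x
  proof (rule proj_eqI[OF assms])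
    show "c *\<^sub>C x - c *\<^sub>C proj M x \<in> orth M"
      using O(4)[OF p(2)[of x]] by (simp flip: scaleC_diff_right)
  qed (intro M p)
qed (use proj_in[OF assms] norm_proj_le[OF assms] in auto)

lemma bounded_ops_compose:
  assumes "A \<in> bounded_ops M K" "B \<in> bounded_ops K L"
  shows "(\<lambda>x. B (A x)) \<in> bounded_ops M L"
proof -
  obtain a b where a: "\<forall>x\<in>M. norm (A x) \<le> a * norm x" and b: "\<forall>x\<in>K. norm (B x) \<le> b * norm x"
    using assms by (auto simp: bounded_ops_def)
  show ?thesis
  proof (rule bounded_opsI[where B = "\<bar>b\<bar> * a"])
    fix x assume x: "x \<in> M"
    have "norm (B (A x)) \<le> b * norm (A x)" using b bounded_opsD(1)[OF assms(1) x] by blast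
    also have "\<dots> \<le> \<bar>b\<bar> * norm (A x)" by (intro mult_right_mono) auto
    also have "\<dots> \<le> \<bar>b\<bar> * (a * norm x)" using a x by (intro mult_left_mono) auto
    finally show "norm (B (A x)) \<le> \<bar>b\<bar> * a * norm x" by simp
  qed (auto simp: bounded_opsD[OF assms(1)] bounded_opsD[OF assms(2)])
qed

lemma bounded_ops_restrict: "A \<in> bounded_ops M K \<Longrightarrow> L \<subseteq> M \<Longrightarrow> A \<in> bounded_ops L K"
  unfolding bounded_ops_def by blast

lemma bounded_ops_codomain: "A \<in> bounded_ops M K \<Longrightarrow> (\<And>x. x \<in> M \<Longrightarrow> A x \<in> L) \<Longrightarrow> A \<in> bounded_ops M L"
  by (auto simp: bounded_ops_def)

lemma closed_csubspace_closure_range: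
  assumes "A \<in> bounded_ops UNIV K"
  shows "closed_csubspace (closure (range A))"
proof (rule closed_csubspaceI)
  note A = bounded_opsD(2,3)[OF assms, simplified]
  have lim: "x \<in> closure (range A) \<longleftrightarrow> (\<exists>s. (\<lambda>n. A (s n)) \<longlonglongrightarrow> x)" for x
    unfolding closure_sequential by (metis (no_types, lifting) UNIV_I f_inv_into_f image_eqI ext)
  have "A 0 = 0" using A(1)[of 0 0] by simp
  then show "0 \<in> closure (range A)" using closure_subset by (metis rangeI subsetD)
  show "x + y \<in> closure (range A)" if "x \<in> closure (range A)" "y \<in> closure (range A)" for x y
  proof -
    obtain s t where "(\<lambda>n. A (s n)) \<longlonglongrightarrow> x" "(\<lambda>n. A (t n)) \<longlonglongrightarrow> y"
      using \<open>x \<in> _\<close> \<open>y \<in> _\<close> unfolding lim by blast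
    then have "(\<lambda>n. A (s n + t n)) \<longlonglongrightarrow> x + y" unfolding A by (rule tendsto_add)
    then show ?thesis unfolding lim by (rule exI[of _ "\<lambda>n. s n + t n"])
  qed
  show "c *\<^sub>C x \<in> closure (range A)" if "x \<in> closure (range A)" for c x
  proof -
    obtain s where "(\<lambda>n. A (s n)) \<longlonglongrightarrow> x" using \<open>x \<in> _\<close> unfolding lim by blast
    then have "(\<lambda>n. A (c *\<^sub>C s n)) \<longlonglongrightarrow> c *\<^sub>C x"
      unfolding A by (rule bounded_linear.tendsto[OF bounded_linear_scaleC])
    then show ?thesis unfolding lim by (rule exI[of _ "\<lambda>n. c *\<^sub>C s n"])
  qed
qed simp

lemma bounded_ops_cong:
  assumes "closed_csubspace M" "A \<in> bounded_ops M K" "\<And>x. x \<in> M \<Longrightarrow> B x = A x"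
  shows "B \<in> bounded_ops M K"
proof -
  obtain b where "\<forall>x\<in>M. norm (A x) \<le> b * norm x" using assms(2) by (auto simp: bounded_ops_def)
  then show ?thesis
    using bounded_opsD[OF assms(2)] closed_csubspaceD(2,4)[OF assms(1)]
    by (intro bounded_opsI[where B = b]) (simp_all add: assms(3))
qed

section \<open>Adjoints\<close>

text \<open>A nonzero functional is determined by its kernel up to a scalar factor, and so is the
  inner product with a vector \<open>w\<close> orthogonal to that kernel; rescaling \<open>w\<close> makes the two agree.\<close>

lemma riesz_representation:
  fixes A :: "'a::complex_hilbert \<Rightarrow> 'a"
  assumes "A \<in> bounded_ops UNIV UNIV"
  obtains v where "\<And>u. cinner (A u) y = cinner u v"
proof -
  note A = bounded_opsD(2,3)[OF assms]
  define f where "f u = cinner (A u) y" for u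
  have f: "f (u + w) = f u + f w" "f (c *\<^sub>C u) = c * f u" "bounded_linear f" for u w c
    using A unfolding f_def
    by (auto simp: cinner_add_left cinner_scaleC_left intro: bounded_linear_compose[OF
        bounded_linear_cinner_left bounded_ops_bounded_linear[OF assms]])
  let ?K = "f -` {0}"
  have K: "closed_csubspace ?K"
    using f(1,2) by (intro closed_csubspaceI closed_vimage linear_continuous_on f(3))
      (auto simp: linear_0[OF bounded_linear.linear[OF f(3)]])
  show ?thesis
  proof (cases "?K = UNIV")
    case True
    then have "\<And>u. f u = 0" by auto
    then show ?thesis using that[of 0] by (simp add: f_def)
  next
    case False
    then obtain u0 where u0: "f u0 \<noteq> 0" by auto
    define w where "w = u0 - proj ?K u0"
    have w: "w \<in> orth ?K" "f w \<noteq> 0"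
      using proj_orth[OF K] proj_in[OF K, of u0] u0 linear_diff[OF bounded_linear.linear[OF f(3)]]
      by (auto simp: w_def)
    have "w \<noteq> 0" using w(2) linear_0[OF bounded_linear.linear[OF f(3)]] by auto
    have "f u = cinner u ((cnj (f w) / of_real ((norm w)\<^sup>2)) *\<^sub>C w)" for u
    proof -
      have "f (u - (f u / f w) *\<^sub>C w) = 0"
        using w(2) by (simp add: linear_diff[OF bounded_linear.linear[OF f(3)]] f(2))
      then have "cinner (u - (f u / f w) *\<^sub>C w) w = 0" using orthD(2)[OF w(1)] by auto
      then have "cinner u w = f u / f w * of_real ((norm w)\<^sup>2)"
        by (simp add: cinner_diff_left cinner_scaleC_left cinner_self)
      then show ?thesis using w(2) \<open>w \<noteq> 0\<close> by (simp add: cinner_scaleC_right)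
    qed
    then show ?thesis using that unfolding f_def by blast
  qed
qed

lemma adj_on_eqI:
  assumes "closed_csubspace M" "x \<in> M" "\<And>u. u \<in> M \<Longrightarrow> cinner (A u) y = cinner u x"
  shows "adj_on M A y = x"
  unfolding adj_on_def
proof (rule the_equality)
  fix v assume v: "v \<in> M \<and> (\<forall>u\<in>M. cinner (A u) y = cinner u v)"
  then have vx: "v - x \<in> M" using closed_csubspaceD(3)[OF assms(1)] assms(2) by blast
  then have "cinner (v - x) v = cinner (v - x) x" using v assms(3) by metis
  then have "cinner (v - x) (v - x) = 0" by (simp add: cinner_diff_right)
  then show "v = x" by simp
qed (use assms in blast)

lemma cinner_adj:
  assumes "A \<in> bounded_ops UNIV UNIV"
  shows "cinner (A u) y = cinner u (adj A y)"
proof -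
  obtain v where v: "\<And>u. cinner (A u) y = cinner u v" using riesz_representation[OF assms] by metis
  then have "adj A y = v" by (intro adj_on_eqI) auto
  then show ?thesis using v by simp
qed

lemma cinner_adj':
  assumes "A \<in> bounded_ops UNIV UNIV"
  shows "cinner (adj A y) u = cinner y (A u)"
  using cinner_adj[OF assms] by (metis cinner_commute)

lemma adj_adj: "A \<in> bounded_ops UNIV UNIV \<Longrightarrow> adj (adj A) = A"
  by (rule ext, rule adj_on_eqI) (auto simp: cinner_adj')

lemma contraction_iff:
  "contraction T \<longleftrightarrow> T \<in> bounded_ops UNIV UNIV \<and> (\<forall>x. norm (T x) \<le> norm x)"
proof -
  have "onorm T \<le> 1 \<longleftrightarrow> (\<forall>x. norm (T x) \<le> norm x)" if "T \<in> bounded_ops UNIV UNIV"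
  proof
    assume "onorm T \<le> 1"
    show "\<forall>x. norm (T x) \<le> norm x"
    proof
      fix x
      have "norm (T x) \<le> onorm T * norm x"
        using onorm[OF bounded_ops_bounded_linear[OF that]] by blast
      also have "\<dots> \<le> 1 * norm x" using \<open>onorm T \<le> 1\<close> by (intro mult_right_mono) auto
      finally show "norm (T x) \<le> norm x" by simp
    qed
  qed (auto intro!: onorm_bound)
  then show ?thesis unfolding contraction_def by blast
qed

lemma adj_contraction:
  assumes "contraction T"
  shows "contraction (adj T)"
proof -
  have T: "T \<in> bounded_ops UNIV UNIV" "\<And>x. norm (T x) \<le> norm x"
    using assms by (auto simp: contraction_iff)
  have le: "norm (adj T y) \<le> norm y" for y
  proof -
    have "of_real ((norm (adj T y))\<^sup>2) = cinner (T (adj T y)) y"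
      by (simp add: cinner_adj[OF T(1)] cinner_self)
    then have "(norm (adj T y))\<^sup>2 \<le> norm (T (adj T y)) * norm y"
      using norm_cinner_le[of "T (adj T y)" y] by (metis abs_of_nonneg norm_of_real zero_le_power2)
    also have "\<dots> \<le> norm (adj T y) * norm y" by (intro mult_right_mono T) auto
    finally show ?thesis
      by (cases "adj T y = 0") (simp_all add: power2_eq_square)
  qed
  have "adj T \<in> bounded_ops UNIV UNIV"
  proof (rule bounded_opsI[where B = 1])
    show "adj T (x + y) = adj T x + adj T y" for x y
      by (rule cinner_ext) (simp add: cinner_add_left cinner_adj'[OF T(1)])
    show "adj T (c *\<^sub>C x) = c *\<^sub>C adj T x" for c x
      by (rule cinner_ext) (simp add: cinner_scaleC_left cinner_adj'[OF T(1)])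
  qed (use le in auto)
  then show ?thesis using le by (simp add: contraction_iff)
qed

section \<open>Positive square roots\<close>

definition selfadjoint :: "('a::complex_hilbert \<Rightarrow> 'a) \<Rightarrow> bool" where
  "selfadjoint A \<longleftrightarrow> (\<forall>x y. cinner (A x) y = cinner x (A y))"

lemma positive_op_selfadjoint:
  assumes "positive_op R"
  shows "selfadjoint R"
proof -
  have B: "R \<in> bounded_ops UNIV UNIV" and pos: "\<And>x. cinner (R x) x \<in> \<real>\<^sub>\<ge>\<^sub>0"
    using assms by (auto simp: positive_op_def)
  note R = bounded_opsD(2,3)[OF B, simplified]
  have real: "cnj (cinner (R x) x) = cinner (R x) x" for x
    using pos[of x] by (auto simp: nonneg_Reals_def)
  have "cinner (R x) y = cinner x (R y)" for x y
  proof -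
    define p q where "p = cinner (R x) y" and "q = cinner (R y) x"
    \<comment> \<open>Polarisation: the form is real on \<open>x + y\<close> and on \<open>x + \<i> y\<close>.\<close>
    have "cnj (p + q) = p + q"
      using real[of "x + y"] real[of x] real[of y]
      by (simp add: p_def q_def R cinner_add_left cinner_add_right add.commute)
    moreover have "cnj (\<i> * q - \<i> * p) = \<i> * q - \<i> * p"
      using real[of "x + \<i> *\<^sub>C y"] real[of x] real[of y]
      by (simp add: p_def q_def R cinner_add_left cinner_add_right cinner_scaleC_left
          cinner_scaleC_right algebra_simps)
    ultimately have "p = cnj q" by (simp add: complex_eq_iff)
    then show ?thesis unfolding p_def q_def by (metis cinner_commute)
  qed
  then show ?thesis by (simp add: selfadjoint_def)
qed

text \<open>The form \<open>\<langle>R x, x\<rangle>\<close> attains its minimum \<open>0\<close> at \<open>y\<close>, so its derivative at \<open>y\<close> in the direction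
  \<open>R y\<close>, which is \<open>2 \<parallel>R y\<parallel>\<^sup>2\<close>, is zero.\<close>

lemma positive_op_form_eq_0:
  assumes "positive_op R" "cinner (R y) y = 0"
  shows "R y = 0"
proof -
  have B: "R \<in> bounded_ops UNIV UNIV" and pos: "\<And>x. cinner (R x) x \<in> \<real>\<^sub>\<ge>\<^sub>0"
    using assms by (auto simp: positive_op_def)
  note R = bounded_ops_bounded_linear[OF B]
  have pos: "inner (R x) x \<ge> 0" for x
    using pos[of x] by (metis Re_cinner nonneg_Reals_def complex_nonneg_Reals_iff)
  define c where "c = inner (R (R y)) (R y)"
  have sa: "inner (R (R y)) y = (norm (R y))\<^sup>2"
    using positive_op_selfadjoint[OF assms(1)]
    unfolding selfadjoint_def power2_norm_eq_inner by (metis Re_cinner)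
  have ineq: "0 \<le> 2 * t * (norm (R y))\<^sup>2 + t\<^sup>2 * c" for t
  proof -
    have "inner (R y) y = 0" using assms(2) by (metis Re_cinner zero_complex.simps(1))
    then have "inner (R (y + t *\<^sub>R R y)) (y + t *\<^sub>R R y) = 2 * t * (norm (R y))\<^sup>2 + t\<^sup>2 * c"
      using sa by (simp add: linear_add[OF bounded_linear.linear[OF R]]
          linear_scale[OF bounded_linear.linear[OF R]] inner_add_left inner_add_right c_def
          dot_square_norm algebra_simps power2_eq_square)
    then show ?thesis using pos by metis
  qed
  have "(norm (R y))\<^sup>2 = 0"
  proof (rule ccontr)
    assume "(norm (R y))\<^sup>2 \<noteq> 0"
    then have n: "(norm (R y))\<^sup>2 > 0" by (metis zero_less_power2 power2_eq_square zero_eq_power2)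
    have c: "c \<ge> 0" using pos by (simp add: c_def)
    \<comment> \<open>A negative \<open>t\<close> so small that the linear term dominates; \<open>c + 1\<close> instead of \<open>c\<close> avoids
      dividing by zero.\<close>
    define t where "t = - ((norm (R y))\<^sup>2 / (c + 1))"
    have "t < 0" using n c by (simp add: t_def)
    moreover have "2 * (norm (R y))\<^sup>2 + t * c > 0"
    proof -
      have "(norm (R y))\<^sup>2 * (c / (c + 1)) \<le> (norm (R y))\<^sup>2 * 1"
        using c n by (intro mult_left_mono) auto
      then have "- t * c < 2 * (norm (R y))\<^sup>2" using n unfolding t_def
        by (simp only: minus_minus times_divide_eq_left times_divide_eq_right mult_1_right)
      then show ?thesis by simp
    qed
    ultimately have "t * (2 * (norm (R y))\<^sup>2 + t * c) < 0" by (rule mult_neg_pos)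
    then show False using ineq[of t] by (simp add: power2_eq_square algebra_simps)
  qed
  then show ?thesis by simp
qed

text \<open>Two commuting positive square roots \<open>R\<close>, \<open>Q\<close> of the same operator agree: with
  \<open>y = (R - Q) x\<close> the two nonnegative numbers \<open>\<langle>R y, y\<rangle>\<close> and \<open>\<langle>Q y, y\<rangle>\<close> add up to
  \<open>\<langle>(R\<^sup>2 - Q\<^sup>2) x, y\<rangle> = 0\<close>.\<close>

lemma positive_square_roots_eq:
  assumes R: "positive_op R" and Q: "positive_op Q"
    and sq: "\<And>x. R (R x) = Q (Q x)" and comm: "\<And>x. R (Q x) = Q (R x)"
  shows "R = Q"
proof
  fix x
  have BR: "R \<in> bounded_ops UNIV UNIV" and BQ: "Q \<in> bounded_ops UNIV UNIV"
    using R Q by (auto simp: positive_op_def)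
  note lR = bounded_linear.linear[OF bounded_ops_bounded_linear[OF BR]]
  note lQ = bounded_linear.linear[OF bounded_ops_bounded_linear[OF BQ]]
  define y where "y = R x - Q x"
  have "R y + Q y = 0" by (simp add: y_def linear_diff[OF lR] linear_diff[OF lQ] sq comm)
  then have "cinner (R y) y + cinner (Q y) y = 0" by (metis cinner_add_left cinner_zero_left)
  moreover have "cinner (R y) y \<in> \<real>\<^sub>\<ge>\<^sub>0" "cinner (Q y) y \<in> \<real>\<^sub>\<ge>\<^sub>0"
    using R Q by (auto simp: positive_op_def)
  ultimately have "cinner (R y) y = 0" "cinner (Q y) y = 0"
    by (auto simp: complex_nonneg_Reals_iff complex_eq_iff)
  then have y0: "R y = 0" "Q y = 0"
    using positive_op_form_eq_0 R Q by blast+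
  have "cinner y y = cinner x (R y) - cinner x (Q y)"
    using positive_op_selfadjoint[OF R] positive_op_selfadjoint[OF Q]
    by (metis cinner_diff_left selfadjoint_def y_def)
  then show "R x = Q x" using y0 by (simp add: y_def)
qed

text \<open>For a self-adjoint contraction \<open>B\<close> a fixed point \<open>Y\<close> of \<open>Y \<mapsto> (B + Y\<^sup>2) / 2\<close> satisfies
  \<open>(I - Y)\<^sup>2 = I - B\<close>. The iteration from \<open>0\<close> is dominated, increment by increment, by the same
  iteration for the scalar \<open>1\<close> in place of \<open>B\<close>, which is increasing and bounded by \<open>1\<close>; this gives
  pointwise convergence.\<close>

primrec sqrt_iter :: "('a::real_vector \<Rightarrow> 'a) \<Rightarrow> nat \<Rightarrow> 'a \<Rightarrow> 'a" where
  "sqrt_iter B 0 = (\<lambda>x. 0)"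
| "sqrt_iter B (Suc n) = (\<lambda>x. (1/2) *\<^sub>R (B x + sqrt_iter B n (sqrt_iter B n x)))"

primrec scalar_iter :: "nat \<Rightarrow> real" where
  "scalar_iter 0 = 0"
| "scalar_iter (Suc n) = (1 + (scalar_iter n)\<^sup>2) / 2"

lemma scalar_iter_bounds: "0 \<le> scalar_iter n" "scalar_iter n \<le> 1"
proof -
  have "0 \<le> scalar_iter n \<and> scalar_iter n \<le> 1"
    by (induction n) (auto simp: power_le_one)
  then show "0 \<le> scalar_iter n" "scalar_iter n \<le> 1" by auto
qed

lemma scalar_iter_mono: "m \<le> n \<Longrightarrow> scalar_iter m \<le> scalar_iter n"
proof (rule lift_Suc_mono_le)
  show "scalar_iter k \<le> scalar_iter (Suc k)" for k
    using zero_le_power2[of "scalar_iter k - 1"] by (simp add: power2_eq_square algebra_simps)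
qed

lemma convergent_scalar_iter: "convergent scalar_iter"
proof (rule Bseq_mono_convergent)
  show "Bseq scalar_iter"
    using scalar_iter_bounds by (intro BseqI'[where K = 1]) simp
qed (simp add: scalar_iter_mono)

locale selfadjoint_contraction =
  fixes B :: "'a::complex_hilbert \<Rightarrow> 'a"
  assumes B: "contraction B" and sa: "selfadjoint B"
begin

abbreviation "Y \<equiv> sqrt_iter B"

lemma B_facts: "B \<in> bounded_ops UNIV UNIV" "norm (B x) \<le> norm x"
  "B (x + y) = B x + B y" "B (c *\<^sub>C x) = c *\<^sub>C B x" "B (x - y) = B x - B y"
  "B (r *\<^sub>R x) = r *\<^sub>R B x" "B 0 = 0"
proof -
  show B: "B \<in> bounded_ops UNIV UNIV" "norm (B x) \<le> norm x" using B by (auto simp: contraction_iff)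
  note l = bounded_linear.linear[OF bounded_ops_bounded_linear[OF B(1)]]
  show "B (x + y) = B x + B y" "B (c *\<^sub>C x) = c *\<^sub>C B x" "B (x - y) = B x - B y"
    "B (r *\<^sub>R x) = r *\<^sub>R B x" "B 0 = 0"
    using bounded_opsD(2,3)[OF B(1)] linear_diff[OF l] linear_scale[OF l] linear_0[OF l] by auto
qed

lemma Y_linear: "Y n (x + y) = Y n x + Y n y" "Y n (c *\<^sub>C x) = c *\<^sub>C Y n x"
  "Y n (x - y) = Y n x - Y n y" "Y n (r *\<^sub>R x) = r *\<^sub>R Y n x" "Y n 0 = 0"
proof -
  have "(\<forall>x y. Y n (x + y) = Y n x + Y n y) \<and> (\<forall>c x. Y n (c *\<^sub>C x) = c *\<^sub>C Y n x)"
  proof (induction n)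
    case (Suc n)
    then show ?case
      by (simp add: B_facts scaleC_add_right scaleC_scaleR scaleR_add_right)
  qed simp
  then have *: "\<And>x y. Y n (x + y) = Y n x + Y n y" "\<And>c x. Y n (c *\<^sub>C x) = c *\<^sub>C Y n x" by auto
  then show "Y n (x + y) = Y n x + Y n y" "Y n (c *\<^sub>C x) = c *\<^sub>C Y n x"
    "Y n (r *\<^sub>R x) = r *\<^sub>R Y n x" by (auto simp flip: scaleC_of_real)
  show "Y n (x - y) = Y n x - Y n y" using *(1)[of "x - y" y] by simp
  show "Y n 0 = 0" using *(1)[of 0 0] by simp
qed

lemma norm_Y_le: "norm (Y n x) \<le> scalar_iter n * norm x"
proof (induction n arbitrary: x)
  case (Suc n)
  have "norm (Y (Suc n) x) \<le> (1/2) * (norm (B x) + norm (Y n (Y n x)))"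
    by (simp add: norm_triangle_ineq)
  also have "\<dots> \<le> (1/2) * (norm x + scalar_iter n * (scalar_iter n * norm x))"
    using B_facts(2)[of x] order_trans[OF Suc[of "Y n x"] mult_left_mono[OF Suc[of x] scalar_iter_bounds(1)]]
    by simp
  finally show ?case by (simp add: power2_eq_square algebra_simps)
qed simp

text \<open>Each \<open>Y n\<close> is a polynomial in \<open>B\<close>, so it commutes with every linear map that commutes with \<open>B\<close>;
  in particular the iterates commute with each other.\<close>

lemma Y_commute_op:
  assumes "\<And>x y. C (x + y) = C x + C y" "\<And>r x. C (r *\<^sub>R x) = r *\<^sub>R C x" "\<And>x. C (B x) = B (C x)"
  shows "C (Y n x) = Y n (C x)"
proof (induction n arbitrary: x)
  case 0
  then show ?case using assms(1)[of 0 0] by simp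
next
  case (Suc n)
  then show ?case by (simp add: assms)
qed

lemma Y_commute: "Y m (Y n x) = Y n (Y m x)"
proof (rule Y_commute_op)
  show "Y m (B x) = B (Y m x)" for x
    by (rule Y_commute_op[symmetric]) (simp_all add: B_facts)
qed (simp_all add: Y_linear)

text \<open>As the iterates commute,
  \<open>Y\<^sub>n\<^sub>+\<^sub>2 - Y\<^sub>n\<^sub>+\<^sub>1 = (Y\<^sub>n\<^sub>+\<^sub>1 + Y\<^sub>n) (Y\<^sub>n\<^sub>+\<^sub>1 - Y\<^sub>n) / 2\<close>. Bounding each factor by its scalar counterpart gives
  the same factorisation of the scalar increment.\<close>

lemma Y_increment: "norm (Y (Suc n) x - Y n x) \<le> (scalar_iter (Suc n) - scalar_iter n) * norm x"
proof (induction n arbitrary: x)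
  case 0
  show ?case using B_facts(2)[of x] by simp
next
  case (Suc n)
  define d where "d = Y (Suc n) x - Y n x"
  have eq: "Y (Suc (Suc n)) x - Y (Suc n) x = (1/2) *\<^sub>R (Y (Suc n) d + Y n d)"
  proof -
    have "Y (Suc n) d + Y n d = Y (Suc n) (Y (Suc n) x) - Y n (Y n x)"
      using Y_commute[of "Suc n" n x] by (simp only: d_def Y_linear(3)) simp
    moreover have "Y (Suc (Suc n)) x - Y (Suc n) x
        = (1/2) *\<^sub>R (Y (Suc n) (Y (Suc n) x) - Y n (Y n x))"
      unfolding sqrt_iter.simps(2)[of B "Suc n"]
      by (subst (3) sqrt_iter.simps(2)) (simp add: scaleR_diff_right[symmetric] del: sqrt_iter.simps)
    ultimately show ?thesis by simp
  qed
  have nd: "norm d \<le> (scalar_iter (Suc n) - scalar_iter n) * norm x"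
    using Suc unfolding d_def .
  have "norm (Y (Suc (Suc n)) x - Y (Suc n) x) \<le> (1/2) * (norm (Y (Suc n) d) + norm (Y n d))"
    unfolding eq by (simp add: norm_triangle_ineq del: sqrt_iter.simps)
  also have "\<dots> \<le> (1/2) * (scalar_iter (Suc n) * norm d + scalar_iter n * norm d)"
    by (intro mult_left_mono add_mono norm_Y_le) simp
  also have "\<dots> = (1/2) * (scalar_iter (Suc n) + scalar_iter n) * norm d" by (simp add: algebra_simps)
  also have "\<dots> \<le> (1/2) * (scalar_iter (Suc n) + scalar_iter n)
      * ((scalar_iter (Suc n) - scalar_iter n) * norm x)"
    using scalar_iter_bounds(1)[of n] scalar_iter_bounds(1)[of "Suc n"]
    by (intro mult_left_mono nd mult_nonneg_nonneg add_nonneg_nonneg) auto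
  also have "\<dots> = (scalar_iter (Suc (Suc n)) - scalar_iter (Suc n)) * norm x"
  proof -
    have "(1/2) * (a + b) * (a - b) = c - a" if "a = (1 + b\<^sup>2) / 2" "c = (1 + a\<^sup>2) / 2" for a b c :: real
      unfolding that(2) unfolding that(1) by (simp add: power2_eq_square field_simps)
    from this[OF scalar_iter.simps(2) scalar_iter.simps(2)] show ?thesis
      by (simp only: mult.assoc[symmetric])
  qed
  finally show ?case .
qed

lemma Y_diff: "m \<le> n \<Longrightarrow> norm (Y n x - Y m x) \<le> (scalar_iter n - scalar_iter m) * norm x"
proof (induction n rule: dec_induct)
  case (step n)
  have "norm (Y (Suc n) x - Y m x) \<le> norm (Y (Suc n) x - Y n x) + norm (Y n x - Y m x)"
    using norm_triangle_ineq[of "Y (Suc n) x - Y n x" "Y n x - Y m x"] by simp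
  then show ?case using step.IH Y_increment[of n x] by 
      (simp add: algebra_simps del: sqrt_iter.simps scalar_iter.simps)
qed simp

lemma convergent_Y: "convergent (\<lambda>n. Y n x)"
proof -
  have "Cauchy (\<lambda>n. Y n x)"
  proof (rule metric_CauchyI)
    fix e :: real assume e: "e > 0"
    have "Cauchy scalar_iter" using convergent_scalar_iter by (rule convergent_Cauchy)
    then obtain K where K: "\<And>m n. m \<ge> K \<Longrightarrow> n \<ge> K \<Longrightarrow>
        dist (scalar_iter m) (scalar_iter n) < e / (norm x + 1)"
      using metric_CauchyD[of scalar_iter "e / (norm x + 1)"] e
      by (meson divide_pos_pos norm_ge_zero add_nonneg_pos zero_less_one)
    have le: "dist (Y m x) (Y n x) \<le> dist (scalar_iter m) (scalar_iter n) * norm x" for m n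
    proof (cases "m \<le> n")
      case True
      then show ?thesis using Y_diff[OF True, of x] scalar_iter_mono[OF True]
        by (simp add: dist_norm norm_minus_commute)
    next
      case False
      then have "n \<le> m" by simp
      then show ?thesis using Y_diff[of n m x] scalar_iter_mono[of n m]
        by (simp add: dist_norm norm_minus_commute)
    qed
    have "dist (Y m x) (Y n x) < e" if "m \<ge> K" "n \<ge> K" for m n
    proof -
      have "dist (Y m x) (Y n x) \<le> e / (norm x + 1) * norm x"
        using le[of m n] K[OF that] by (meson less_imp_le mult_right_mono norm_ge_zero order_trans)
      also have "\<dots> < e"
        using e norm_ge_zero[of x] by (simp add: divide_less_eq add_nonneg_pos ring_distribs del: norm_ge_zero)
      finally show ?thesis .
    qed
    then show "\<exists>K. \<forall>m\<ge>K. \<forall>n\<ge>K. dist (Y m x) (Y n x) < e" by blast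
  qed
  then show ?thesis by (rule Cauchy_convergent)
qed

definition Ylim :: "'a \<Rightarrow> 'a" where "Ylim x = lim (\<lambda>n. Y n x)"

lemma Y_tendsto: "(\<lambda>n. Y n x) \<longlonglongrightarrow> Ylim x"
  using convergent_Y unfolding Ylim_def by (simp add: convergent_LIMSEQ_iff)

lemma norm_Y_le': "norm (Y n x) \<le> norm x"
  using norm_Y_le[of n x] scalar_iter_bounds[of n]
  by (meson mult_left_le_one_le norm_ge_zero order_trans)

lemma Ylim_linear: "Ylim (x + y) = Ylim x + Ylim y" "Ylim (c *\<^sub>C x) = c *\<^sub>C Ylim x" "norm (Ylim x) \<le> norm x"
proof -
  show "Ylim (x + y) = Ylim x + Ylim y"
    using tendsto_add[OF Y_tendsto[of x] Y_tendsto[of y]] Y_tendsto[of "x + y"]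
    by (simp add: Y_linear LIMSEQ_unique)
  show "Ylim (c *\<^sub>C x) = c *\<^sub>C Ylim x"
    using bounded_linear.tendsto[OF bounded_linear_scaleC Y_tendsto[of x]] Y_tendsto[of "c *\<^sub>C x"]
    by (simp add: Y_linear LIMSEQ_unique)
  show "norm (Ylim x) \<le> norm x"
    by (rule LIMSEQ_le_const2[OF tendsto_norm[OF Y_tendsto]]) (simp add: norm_Y_le')
qed

lemma Ylim_fixed_point: "2 *\<^sub>R Ylim x = B x + Ylim (Ylim x)"
proof -
  have "(\<lambda>n. Y n (Y n x - Ylim x)) \<longlonglongrightarrow> 0"
  proof (rule Lim_null_comparison)
    show "(\<lambda>n. norm (Y n x - Ylim x)) \<longlonglongrightarrow> 0"
      using Y_tendsto[of x] by (simp add: LIM_zero_iff tendsto_norm_zero)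
  qed (simp add: norm_Y_le')
  from tendsto_add[OF this Y_tendsto[of "Ylim x"]]
  have "(\<lambda>n. Y n (Y n x)) \<longlonglongrightarrow> Ylim (Ylim x)" by (simp add: Y_linear)
  then have "(\<lambda>n. (1/2) *\<^sub>R (B x + Y n (Y n x))) \<longlonglongrightarrow> (1/2) *\<^sub>R (B x + Ylim (Ylim x))"
    by (intro tendsto_intros)
  then have "(\<lambda>n. Y (Suc n) x) \<longlonglongrightarrow> (1/2) *\<^sub>R (B x + Ylim (Ylim x))" by simp
  then have "Ylim x = (1/2) *\<^sub>R (B x + Ylim (Ylim x))"
    using LIMSEQ_Suc[OF Y_tendsto[of x]] LIMSEQ_unique by blast
  then show ?thesis by (metis scaleR_half_double scaleR_2 scaleR_right.add)
qed

lemma Ylim_selfadjoint: "selfadjoint Ylim"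
proof -
  have Ysa: "cinner (Y n x) y = cinner x (Y n y)" for n x y
  proof (induction n arbitrary: x y)
    case (Suc n)
    then show ?case using sa
      by (simp add: selfadjoint_def cinner_scaleR_left cinner_scaleR_right cinner_add_left cinner_add_right)
  qed simp
  have "cinner (Ylim x) y = cinner x (Ylim y)" for x y
  proof -
    have "(\<lambda>n. cinner (Y n x) y) \<longlonglongrightarrow> cinner (Ylim x) y"
      by (rule bounded_linear.tendsto[OF bounded_linear_cinner_left Y_tendsto])
    moreover have "(\<lambda>n. cinner x (Y n y)) \<longlonglongrightarrow> cinner x (Ylim y)"
      by (rule bounded_linear.tendsto[OF bounded_linear_cinner_right Y_tendsto])
    ultimately show ?thesis by (simp add: Ysa LIMSEQ_unique)
  qed
  then show ?thesis by (simp add: selfadjoint_def)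
qed

definition root :: "'a \<Rightarrow> 'a" where "root x = x - Ylim x"

lemma root_positive: "positive_op root"
proof -
  have "root \<in> bounded_ops UNIV UNIV"
  proof (rule bounded_opsI[where B = 2])
    show "norm (root x) \<le> 2 * norm x" for x
      using norm_triangle_ineq4[of x "Ylim x"] Ylim_linear(3)[of x] by (simp add: root_def)
  qed (simp_all add: root_def Ylim_linear scaleC_diff_right)
  moreover have "cinner (root x) x \<in> \<real>\<^sub>\<ge>\<^sub>0" for x
  proof -
    have "cinner (Ylim x) x = cnj (cinner (Ylim x) x)"
      using Ylim_selfadjoint by (metis cinner_commute selfadjoint_def)
    then have "Im (cinner (Ylim x) x) = 0" by (metis Reals_cnj_iff complex_is_Real_iff)
    moreover have "Re (cinner (Ylim x) x) \<le> (norm x)\<^sup>2"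
    proof -
      have "Re (cinner (Ylim x) x) \<le> norm (Ylim x) * norm x"
        by (simp add: Re_cinner norm_cauchy_schwarz)
      also have "\<dots> \<le> norm x * norm x" by (intro mult_right_mono Ylim_linear(3)) simp
      finally show ?thesis by (simp add: power2_eq_square)
    qed
    ultimately show ?thesis
      by (simp add: root_def cinner_diff_left cinner_self complex_nonneg_Reals_iff)
  qed
  ultimately show ?thesis by (simp add: positive_op_def)
qed

lemma root_square: "root (root x) = x - B x"
proof -
  have "Ylim (x - Ylim x) = Ylim x - Ylim (Ylim x)" using Ylim_linear(1)[of "x - Ylim x" "Ylim x"] by (simp add: eq_diff_eq)
  then have "root (root x) = x - 2 *\<^sub>R Ylim x + Ylim (Ylim x)" by (simp add: root_def scaleR_2)
  then show ?thesis by (simp add: Ylim_fixed_point)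
qed

text \<open>Any positive square root of \<open>I - B\<close> commutes with \<open>B\<close>, hence with the limit \<^term>\<open>Ylim\<close> of
  polynomials in \<open>B\<close>.\<close>

lemma root_unique:
  assumes Q: "positive_op Q" and sq: "\<And>x. Q (Q x) = x - B x"
  shows "Q = root"
proof (rule positive_square_roots_eq[OF Q root_positive])
  show "Q (Q x) = root (root x)" for x by (simp add: sq root_square)
  have BQ: "Q \<in> bounded_ops UNIV UNIV" using Q by (simp add: positive_op_def)
  note bl = bounded_ops_bounded_linear[OF BQ]
  note l = bounded_linear.linear[OF bl]
  have B_eq: "B x = x - Q (Q x)" for x by (simp add: sq)
  have "Q (Y n x) = Y n (Q x)" for n x
    by (rule Y_commute_op) (simp_all add: linear_add[OF l] linear_scale[OF l] B_eq linear_diff[OF l])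
  then have "(\<lambda>n. Y n (Q x)) \<longlonglongrightarrow> Q (Ylim x)" for x
    using bounded_linear.tendsto[OF bl Y_tendsto[of x]] by simp
  then have "Q (Ylim x) = Ylim (Q x)" for x using Y_tendsto LIMSEQ_unique by blast
  then show "Q (root x) = root (Q x)" for x by (simp add: root_def linear_diff[OF l])
qed

lemma sqrt_op_correct:
  shows "positive_op (sqrt_op (\<lambda>x. x - B x))"
    and "sqrt_op (\<lambda>x. x - B x) (sqrt_op (\<lambda>x. x - B x) x) = x - B x"
proof -
  have "sqrt_op (\<lambda>x. x - B x) = root"
    unfolding sqrt_op_def
    by (rule the_equality) (auto simp: root_positive fun_eq_iff root_square
        intro: root_unique[unfolded fun_eq_iff, rule_format])
  then show "positive_op (sqrt_op (\<lambda>x. x - B x))"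
    and "sqrt_op (\<lambda>x. x - B x) (sqrt_op (\<lambda>x. x - B x) x) = x - B x"
    by (simp_all add: root_positive root_square)
qed

end

section \<open>Defect operators\<close>

text \<open>The square of the defect operator. It has the same kernel as the defect operator and its range has
  the same closure, but algebraic identities for it need no square root.\<close>

definition defect2 :: "('a::complex_hilbert \<Rightarrow> 'a) \<Rightarrow> 'a \<Rightarrow> 'a" where
  "defect2 T x = x - adj T (T x)"

lemma contraction_funpow: "contraction T \<Longrightarrow> contraction (T ^^ k)"
proof (induction k)
  case 0
  show ?case by (auto simp: contraction_iff bounded_ops_def intro: exI[of _ 1])
next
  case (Suc k)
  then have *: "contraction T" "contraction (T ^^ k)" by auto
  show ?case
    using bounded_ops_compose[of "T ^^ k" UNIV UNIV T UNIV] * order_trans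
    unfolding contraction_iff by (fastforce simp: o_def)
qed

lemma contraction_linear: "contraction T \<Longrightarrow> bounded_linear T"
  using bounded_ops_bounded_linear contraction_iff by blast

lemma cinner_adj_funpow:
  assumes "contraction T"
  shows "cinner ((T ^^ k) x) y = cinner x ((adj T ^^ k) y)"
proof (induction k arbitrary: y)
  case (Suc k)
  have "cinner ((T ^^ Suc k) x) y = cinner ((T ^^ k) x) (adj T y)"
    using assms by (simp add: contraction_iff cinner_adj)
  then show ?case by (simp add: Suc funpow_swap1)
qed simp

context
  fixes T :: "'a::complex_hilbert \<Rightarrow> 'a"
  assumes T: "contraction T"
begin

lemma T_op: "T \<in> bounded_ops UNIV UNIV"
  using T by (simp add: contraction_iff)

lemma defect2_selfadjoint: "cinner (defect2 T x) y = cinner x (defect2 T y)"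
  by (simp add: defect2_def cinner_diff_left cinner_diff_right cinner_adj[OF T_op, symmetric]
      cinner_adj'[OF T_op])

lemma adjT_T_selfadjoint_contraction: "selfadjoint_contraction (\<lambda>x. adj T (T x))"
proof
  show "contraction (\<lambda>x. adj T (T x))"
    using bounded_ops_compose[of T UNIV UNIV "adj T" UNIV] T adj_contraction[OF T] order_trans
    unfolding contraction_iff by fastforce
  show "selfadjoint (\<lambda>x. adj T (T x))"
    by (simp add: selfadjoint_def cinner_adj[OF T_op, symmetric] cinner_adj'[OF T_op])
qed

lemma defect_op_positive: "positive_op (defect_op T)"
  and defect_op_square: "defect_op T (defect_op T x) = defect2 T x"
  using selfadjoint_contraction.sqrt_op_correct[OF adjT_T_selfadjoint_contraction]
  by (simp_all add: defect_op_def defect2_def)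

lemma defect_op_bounded: "defect_op T \<in> bounded_ops UNIV UNIV"
  using defect_op_positive by (simp add: positive_op_def)

lemma defect_op_selfadjoint: "cinner (defect_op T x) y = cinner x (defect_op T y)"
  using positive_op_selfadjoint[OF defect_op_positive] by (simp add: selfadjoint_def)

lemma bounded_linear_defect_op: "bounded_linear (defect_op T)"
  by (rule bounded_ops_bounded_linear[OF defect_op_bounded])

lemma bounded_linear_defect2: "bounded_linear (defect2 T)"
  using bounded_linear_compose[OF bounded_linear_defect_op bounded_linear_defect_op]
  by (simp add: defect_op_square)

lemma norm_defect_op: "(norm (defect_op T x))\<^sup>2 = (norm x)\<^sup>2 - (norm (T x))\<^sup>2"
proof -
  have "cinner (defect_op T x) (defect_op T x) = cinner (defect2 T x) x"
    by (simp add: defect_op_selfadjoint defect_op_square defect2_selfadjoint)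
  also have "\<dots> = of_real ((norm x)\<^sup>2) - of_real ((norm (T x))\<^sup>2)"
    unfolding defect2_def cinner_diff_left cinner_adj'[OF T_op] cinner_self ..
  finally show ?thesis by (simp only: cinner_self of_real_diff[symmetric] of_real_eq_iff)
qed

lemma defect_op_eq_0_iff: "defect_op T x = 0 \<longleftrightarrow> norm (T x) = norm x"
  using norm_defect_op[of x] by (auto simp: power2_eq_iff_nonneg)

lemma defect2_eq_0_iff: "defect2 T x = 0 \<longleftrightarrow> norm (T x) = norm x"
proof
  assume "defect2 T x = 0"
  then have "cinner (defect_op T x) (defect_op T x) = 0"
    by (simp add: defect_op_selfadjoint defect_op_square)
  then show "norm (T x) = norm x" by (simp add: defect_op_eq_0_iff)
next
  assume "norm (T x) = norm x"
  then have "defect_op T x = 0" by (simp add: defect_op_eq_0_iff)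
  then show "defect2 T x = 0"
    using defect_op_square[of x] linear_0[OF bounded_linear.linear[OF bounded_linear_defect_op]] by simp
qed

lemma T_defect2: "T (defect2 T x) = defect2 (adj T) (T x)"
  using linear_diff[OF bounded_linear.linear[OF contraction_linear[OF T]]]
  by (simp add: defect2_def adj_adj[OF T_op])

lemma defect_op_in_space: "defect_op T x \<in> defect_space T"
  unfolding defect_space_def by (rule subsetD[OF closure_subset rangeI])

text \<open>Both ranges have the same orthogonal complement, because \<open>D\<^sub>T\<close> and \<open>D\<^sub>T\<^sup>2\<close> have the
  same kernel.\<close>

lemma defect_space_eq_closure_defect2: "defect_space T = closure (range (defect2 T))"
proof
  have "range (defect2 T) \<subseteq> range (defect_op T)" by (auto simp flip: defect_op_square)
  then show "closure (range (defect2 T)) \<subseteq> defect_space T"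
    unfolding defect_space_def by (rule closure_mono)
  let ?R = "closure (range (defect2 T))"
  have "defect2 T \<in> bounded_ops UNIV UNIV"
    using bounded_ops_compose[OF defect_op_bounded defect_op_bounded] by (simp add: defect_op_square)
  then have R: "closed_csubspace ?R" by (rule closed_csubspace_closure_range)
  have "defect_op T x \<in> orth (orth ?R)" for x
    unfolding orth_def
  proof safe
    fix w assume w: "\<forall>y\<in>?R. cinner w y = 0"
    have "cinner (defect2 T w) y = 0" for y
      using w closure_subset[of "range (defect2 T)"] by (auto simp: defect2_selfadjoint)
    then have "defect2 T w = 0" using cinner_self_eq_0_iff by blast
    then have "defect_op T w = 0" by (simp add: defect2_eq_0_iff defect_op_eq_0_iff)
    then show "cinner (defect_op T x) w = 0" by (simp add: defect_op_selfadjoint)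
  qed
  then have "range (defect_op T) \<subseteq> ?R" using orth_orth[OF R] by auto
  then show "defect_space T \<subseteq> ?R" unfolding defect_space_def by (simp add: closure_minimal)
qed

end

text \<open>By \<open>T (I - T\<^sup>*T) = (I - TT\<^sup>*) T\<close>, the range of \<open>I - T\<^sup>*T\<close> is mapped into that of \<open>I - TT\<^sup>*\<close>;
  continuity carries this to the closures, which are the defect spaces.\<close>

lemma T_maps_defect_space:
  assumes "contraction T" "x \<in> defect_space T"
  shows "T x \<in> defect_space (adj T)"
proof -
  have "T ` closure (range (defect2 T)) \<subseteq> defect_space (adj T)"
  proof (rule image_closure_subset)
    show "continuous_on (closure (range (defect2 T))) T"
      by (rule linear_continuous_on[OF contraction_linear[OF assms(1)]])
    show "T ` range (defect2 T) \<subseteq> defect_space (adj T)"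
      using closure_subset[of "range (defect2 (adj T))"]
      by (auto simp: T_defect2[OF assms(1)] defect_space_eq_closure_defect2[OF adj_contraction[OF assms(1)]])
  qed (simp add: defect_space_def)
  then show ?thesis using assms(2) by (auto simp: defect_space_eq_closure_defect2[OF assms(1)])
qed

section \<open>The power series of the characteristic function\<close>

fun theta_coeff :: "('a::complex_hilbert \<Rightarrow> 'a) \<Rightarrow> nat \<Rightarrow> 'a \<Rightarrow> 'a" where
  "theta_coeff T 0 x = - T x"
| "theta_coeff T (Suc k) x = defect_op (adj T) ((adj T ^^ k) (defect_op T x))"

lemma theta_coeff_bounded:
  assumes "contraction T"
  shows "theta_coeff T k \<in> bounded_ops (defect_space T) (defect_space (adj T))"
proof (cases k)
  case 0
  have "T \<in> bounded_ops (defect_space T) (defect_space (adj T))"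
    using bounded_ops_codomain[OF bounded_ops_restrict[OF T_op[OF assms]]]
      T_maps_defect_space[OF assms] by blast
  moreover have "- y \<in> defect_space (adj T)" if "y \<in> defect_space (adj T)" for y
    using that unfolding defect_space_def
    by (rule closed_csubspaceD(6)[OF closed_csubspace_closure_range[OF
          defect_op_bounded[OF adj_contraction[OF assms]]]])
  ultimately show ?thesis
    unfolding 0 bounded_ops_def by (simp add: scaleC_minus_right)
next
  case (Suc j)
  have "(\<lambda>x. defect_op (adj T) ((adj T ^^ j) (defect_op T x))) \<in> bounded_ops UNIV UNIV"
    by (rule bounded_ops_compose[OF bounded_ops_compose[OF defect_op_bounded[OF assms]
            T_op[OF contraction_funpow[OF adj_contraction[OF assms]]]]
          defect_op_bounded[OF adj_contraction[OF assms]]])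
  moreover have "theta_coeff T (Suc j) = (\<lambda>x. defect_op (adj T) ((adj T ^^ j) (defect_op T x)))"
    by (simp add: fun_eq_iff)
  ultimately have "theta_coeff T (Suc j) \<in> bounded_ops (defect_space T) UNIV"
    using bounded_ops_restrict by (metis subset_UNIV)
  then show ?thesis unfolding Suc
    by (rule bounded_ops_codomain) (simp add: defect_op_in_space[OF adj_contraction[OF assms]])
qed

instance complex_hilbert \<subseteq> banach ..

lemma neumann_series:
  assumes "contraction A" "cmod z < 1"
  shows "(\<lambda>k. z ^ k *\<^sub>C (A ^^ k) v) sums inv (\<lambda>y. y - z *\<^sub>C A y) v"
proof -
  let ?a = "\<lambda>k. z ^ k *\<^sub>C (A ^^ k) v"
  let ?f = "\<lambda>y. y - z *\<^sub>C A y"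
  note l = bounded_linear.linear[OF contraction_linear[OF assms(1)]]
  have cA: "A (c *\<^sub>C x) = c *\<^sub>C A x" for c x
    using assms(1) bounded_opsD(3)[of A UNIV UNIV] by (simp add: contraction_iff)
  have "summable ?a"
  proof (rule summable_comparison_test')
    show "summable (\<lambda>k. cmod z ^ k * norm v)"
      using assms(2) by (intro summable_mult2 summable_geometric) simp
    show "norm (?a k) \<le> cmod z ^ k * norm v" for k
      using contraction_funpow[OF assms(1), of k]
      by (auto simp: norm_scaleC norm_power contraction_iff intro: mult_left_mono)
  qed
  then have y: "?a sums suminf ?a" by (rule summable_sums)
  have "(\<lambda>k. ?a (Suc k)) sums (z *\<^sub>C A (suminf ?a))"
    using bounded_linear.sums[OF bounded_linear_compose[OF bounded_linear_scaleC
        contraction_linear[OF assms(1)]] y, of z] by (simp add: cA scaleC_scaleC)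
  then have "?f (suminf ?a) = v"
    using sums_unique[of "\<lambda>k. ?a (Suc k)"] suminf_split_head[OF \<open>summable ?a\<close>] by simp
  moreover have "inj ?f"
  proof (rule injI)
    fix x y assume "?f x = ?f y"
    then have "x - y = z *\<^sub>C A (x - y)" by (simp add: linear_diff[OF l] scaleC_diff_right algebra_simps)
    then have "norm (x - y) = cmod z * norm (A (x - y))" by (metis norm_scaleC)
    also have "\<dots> \<le> cmod z * norm (x - y)"
      using assms(1) by (intro mult_left_mono) (auto simp: contraction_iff)
    finally have "norm (x - y) * (1 - cmod z) \<le> 0" by (simp add: algebra_simps)
    then show "x = y" using assms(2) by (simp add: mult_le_0_iff)
  qed
  ultimately have "inv ?f v = suminf ?a" by (intro inv_f_eq)
  then show ?thesis using y by simp
qed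

lemma characteristic_function_sums:
  assumes "contraction T" "cmod z < 1"
  shows "(\<lambda>k. z ^ k *\<^sub>C theta_coeff T k x) sums characteristic_function T z x"
proof -
  note T' = adj_contraction[OF assms(1)]
  have c: "defect_op (adj T) (c *\<^sub>C y) = c *\<^sub>C defect_op (adj T) y" for c y
    using bounded_opsD(3)[OF defect_op_bounded[OF T']] by simp
  have "(\<lambda>k. z ^ Suc k *\<^sub>C theta_coeff T (Suc k) x) sums
      (z *\<^sub>C defect_op (adj T) (inv (\<lambda>y. y - z *\<^sub>C adj T y) (defect_op T x)))"
    using bounded_linear.sums[OF bounded_linear_compose[OF bounded_linear_scaleC
        bounded_linear_defect_op[OF T']] neumann_series[OF T' assms(2)], of z]
    by (simp add: c scaleC_scaleC)
  from sums_Suc[OF this] show ?thesis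
    by (simp add: characteristic_function_def add.commute)
qed

section \<open>Operator polynomials\<close>

text \<open>If the coefficients before the \<open>n\<close>-th are zero, division by \<open>z\<^sup>n\<close> leaves a power series with
  constant term \<open>c n\<close> and sum \<open>0\<close> away from the origin; its limit at the origin is both \<open>0\<close> and
  \<open>c n\<close>.\<close>

lemma power_series_zero_coeff:
  fixes c :: "nat \<Rightarrow> complex"
  assumes "\<And>z. cmod z < 1 \<Longrightarrow> (\<lambda>k. c k * z ^ k) sums 0"
  shows "c n = 0"
proof (induction n rule: less_induct)
  case (less n)
  have "((\<lambda>z. 0) \<longlongrightarrow> c (0 + n)) (at (0::complex))"
  proof (rule powser_limit_0_strong[where s = 1 and a = "\<lambda>k. c (k + n)"])
    fix z :: complex assume z: "z \<noteq> 0" "norm z < 1"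
    have "(\<lambda>k. c (k + n) * z ^ (k + n)) sums (0 - (\<Sum>i<n. c i * z ^ i))"
      using sums_split_initial_segment[OF assms[OF z(2)]] by blast
    then have "(\<lambda>k. c (k + n) * z ^ (k + n) / z ^ n) sums (0 / z ^ n)"
      using less by (intro sums_divide) simp
    then show "(\<lambda>k. c (k + n) * z ^ k) sums 0" using z(1) by (simp add: power_add)
  qed simp
  then show ?case using tendsto_const_iff[of "at (0::complex)" 0 "c n"] by simp
qed

lemma vector_power_series_unique:
  fixes a b :: "nat \<Rightarrow> 'a::complex_inner"
  assumes "\<And>z. cmod z < 1 \<Longrightarrow> (\<lambda>k. z ^ k *\<^sub>C a k) sums s z"
    and "\<And>z. cmod z < 1 \<Longrightarrow> (\<lambda>k. z ^ k *\<^sub>C b k) sums s z"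
  shows "a n = b n"
proof -
  have "cinner (a n - b n) w = 0" for w
  proof (rule power_series_zero_coeff[where c = "\<lambda>n. cinner (a n - b n) w"])
    fix z :: complex assume "cmod z < 1"
    then have "(\<lambda>k. z ^ k *\<^sub>C a k - z ^ k *\<^sub>C b k) sums (s z - s z)"
      by (intro sums_diff assms)
    from bounded_linear.sums[OF bounded_linear_cinner_left this, of w]
    show "(\<lambda>k. cinner (a k - b k) w * z ^ k) sums 0"
      by (simp add: scaleC_diff_right[symmetric] cinner_scaleC_left mult.commute)
  qed
  then show ?thesis by (metis cinner_self_eq_0_iff right_minus_eq)
qed

lemma sums_truncated:
  fixes A :: "nat \<Rightarrow> 'a::complex_inner"
  shows "(\<lambda>k. z ^ k *\<^sub>C (if k \<le> n then A k else 0)) sums (\<Sum>k\<le>n. z ^ k *\<^sub>C A k)"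
  using sums_finite[of "{..n}" "\<lambda>k. z ^ k *\<^sub>C (if k \<le> n then A k else 0)"] by simp

lemma operator_poly_of_degree_unique:
  assumes "operator_poly_of_degree M K F m" "operator_poly_of_degree M K F n"
  shows "m = n"
proof -
  have no_less: "\<not> m < n" if m: "operator_poly_of_degree M K F m" and n: "operator_poly_of_degree M K F n" for m n
  proof
    assume "m < n"
    obtain A where A: "\<forall>z\<in>ball 0 1. \<forall>x\<in>M. F z x = (\<Sum>k\<le>m. z ^ k *\<^sub>C A k x)"
      using m unfolding operator_poly_of_degree_def by blast
    obtain B x where B: "\<forall>z\<in>ball 0 1. \<forall>x\<in>M. F z x = (\<Sum>k\<le>n. z ^ k *\<^sub>C B k x)"
        "x \<in> M" "B n x \<noteq> 0"
      using n \<open>m < n\<close> by (auto simp: operator_poly_of_degree_def)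
    have "(if n \<le> m then A n x else 0) = (if n \<le> n then B n x else 0)"
    proof (rule vector_power_series_unique[where s = "\<lambda>z. F z x" and n = n
          and a = "\<lambda>k. if k \<le> m then A k x else 0" and b = "\<lambda>k. if k \<le> n then B k x else 0"])
      fix z :: complex assume z: "cmod z < 1"
      show "(\<lambda>k. z ^ k *\<^sub>C (if k \<le> m then A k x else 0)) sums F z x"
        using sums_truncated[of z m "\<lambda>k. A k x"] A B(2) z by simp
      show "(\<lambda>k. z ^ k *\<^sub>C (if k \<le> n then B k x else 0)) sums F z x"
        using sums_truncated[of z n "\<lambda>k. B k x"] B z by simp
    qed
    then show False using B(3) \<open>m < n\<close> by simp
  qed
  show ?thesis using no_less[OF assms] no_less[OF assms(2,1)] by simp
qed

text \<open>The dual and square-root free form of the condition that all Taylor coefficients of the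
  characteristic function of index greater than \<open>n\<close> vanish. The index shifts by one because the
  coefficient of \<open>z\<^bsup>k+1\<^esup>\<close> is \<open>D\<^sub>*T\<^sup>*\<^sup>kD\<close>.\<close>

definition theta_vanishes_from :: "('a::complex_hilbert \<Rightarrow> 'a) \<Rightarrow> nat \<Rightarrow> bool" where
  "theta_vanishes_from T n \<longleftrightarrow> (\<forall>k\<ge>n. \<forall>y. defect2 T ((T ^^ k) (defect2 (adj T) y)) = 0)"

text \<open>The operators \<open>D\<^sub>T\<^sup>2 T\<^sup>k D\<^sub>*\<^sup>2\<close> and \<open>D\<^sub>*\<^sup>2 T\<^sup>*\<^sup>k D\<^sub>T\<^sup>2\<close> are adjoint to each other. In the
  second, \<open>D\<^sub>*\<^sup>2\<close> may be replaced by \<open>D\<^sub>*\<close>, which has the same kernel; the product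
  \<open>D\<^sub>* T\<^sup>*\<^sup>k D\<^sub>T D\<^sub>T\<close> is zero iff \<open>D\<^sub>* T\<^sup>*\<^sup>k D\<^sub>T\<close> vanishes on the range of \<open>D\<^sub>T\<close>, equivalently
  on its closure.\<close>

lemma theta_coeff_eq_0_iff:
  assumes "contraction T"
  shows "(\<forall>x\<in>defect_space T. theta_coeff T (Suc k) x = 0) \<longleftrightarrow>
    (\<forall>y. defect2 T ((T ^^ k) (defect2 (adj T) y)) = 0)"
proof -
  note T = assms and T' = adj_contraction[OF assms]
  have dual: "cinner (defect2 T ((T ^^ k) (defect2 (adj T) y))) x
      = cinner y (defect2 (adj T) ((adj T ^^ k) (defect2 T x)))" for x y
    by (simp add: defect2_selfadjoint[OF T] defect2_selfadjoint[OF T'] cinner_adj_funpow[OF T])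
  have "(\<forall>y. defect2 T ((T ^^ k) (defect2 (adj T) y)) = 0) \<longleftrightarrow>
      (\<forall>x. defect2 (adj T) ((adj T ^^ k) (defect2 T x)) = 0)"
  proof safe
    fix x assume "\<forall>y. defect2 T ((T ^^ k) (defect2 (adj T) y)) = 0"
    then show "defect2 (adj T) ((adj T ^^ k) (defect2 T x)) = 0"
      using dual[of "defect2 (adj T) ((adj T ^^ k) (defect2 T x))" x] by simp
  next
    fix y assume "\<forall>x. defect2 (adj T) ((adj T ^^ k) (defect2 T x)) = 0"
    then show "defect2 T ((T ^^ k) (defect2 (adj T) y)) = 0"
      using dual[of y "defect2 T ((T ^^ k) (defect2 (adj T) y))"] by simp
  qed
  also have "\<dots> \<longleftrightarrow> (\<forall>x. theta_coeff T (Suc k) (defect_op T x) = 0)"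
    by (simp add: defect_op_square[OF T] defect_op_eq_0_iff[OF T'] defect2_eq_0_iff[OF T'])
  also have "\<dots> \<longleftrightarrow> (\<forall>x\<in>defect_space T. theta_coeff T (Suc k) x = 0)"
  proof
    assume *: "\<forall>x. theta_coeff T (Suc k) (defect_op T x) = 0"
    have "bounded_linear (\<lambda>x. theta_coeff T (Suc k) x)"
      using bounded_linear_compose[OF bounded_linear_defect_op[OF T'] bounded_linear_compose[OF
            contraction_linear[OF contraction_funpow[OF T', of k]] bounded_linear_defect_op[OF T]]]
      by simp
    then have "theta_coeff T (Suc k) ` closure (range (defect_op T)) \<subseteq> {0}"
      using * by (intro image_closure_subset linear_continuous_on) (auto simp del: theta_coeff.simps)
    then show "\<forall>x\<in>defect_space T. theta_coeff T (Suc k) x = 0"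
      by (auto simp: defect_space_def simp del: theta_coeff.simps)
  qed (use defect_op_in_space[OF T] in blast)
  finally show ?thesis by blast
qed

lemma theta_vanishes_if_poly:
  assumes "contraction T"
    "operator_poly_of_degree (defect_space T) (defect_space (adj T)) (characteristic_function T) n"
  shows "theta_vanishes_from T n"
proof -
  obtain A where A: "\<forall>z\<in>ball 0 1. \<forall>x\<in>defect_space T.
      characteristic_function T z x = (\<Sum>k\<le>n. z ^ k *\<^sub>C A k x)"
    using assms(2) unfolding operator_poly_of_degree_def by blast
  have "theta_coeff T k x = (if k \<le> n then A k x else 0)" if "x \<in> defect_space T" for k x
  proof (rule vector_power_series_unique[where s = "\<lambda>z. characteristic_function T z x" and n = k
        and a = "\<lambda>k. theta_coeff T k x" and b = "\<lambda>k. if k \<le> n then A k x else 0"])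
    fix z :: complex assume z: "cmod z < 1"
    show "(\<lambda>k. z ^ k *\<^sub>C theta_coeff T k x) sums characteristic_function T z x"
      by (rule characteristic_function_sums[OF assms(1) z])
    show "(\<lambda>k. z ^ k *\<^sub>C (if k \<le> n then A k x else 0)) sums characteristic_function T z x"
      using sums_truncated[of z n "\<lambda>k. A k x"] A that z by simp
  qed
  then have "\<forall>x\<in>defect_space T. theta_coeff T (Suc k) x = 0" if "n \<le> k" for k
    using that by (metis not_less_eq_eq)
  then show ?thesis
    unfolding theta_vanishes_from_def theta_coeff_eq_0_iff[OF assms(1), symmetric] by simp
qed

lemma poly_if_theta_vanishes:
  assumes "contraction T" "theta_vanishes_from T n"
  obtains m where "m \<le> n"
    "operator_poly_of_degree (defect_space T) (defect_space (adj T)) (characteristic_function T) m"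
proof -
  let ?P = "\<lambda>m. \<forall>k>m. \<forall>x\<in>defect_space T. theta_coeff T k x = 0"
  \<comment> \<open>The index of the last nonzero coefficient, or \<open>0\<close>: the degree may be smaller than \<open>n\<close>.\<close>
  define m where "m = (LEAST m. ?P m)"
  have "?P n"
  proof (intro allI impI)
    fix k assume "n < k"
    then obtain j where k: "k = Suc j" "n \<le> j" by (cases k) auto
    then have "\<forall>y. defect2 T ((T ^^ j) (defect2 (adj T) y)) = 0"
      using assms(2) by (simp add: theta_vanishes_from_def)
    then show "\<forall>x\<in>defect_space T. theta_coeff T k x = 0"
      unfolding k(1) theta_coeff_eq_0_iff[OF assms(1)] .
  qed
  then have m: "?P m" "m \<le> n"
    unfolding m_def by (rule LeastI[of ?P n]) (rule Least_le[of ?P n], fact)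
  have "m = 0 \<or> (\<exists>x\<in>defect_space T. theta_coeff T m x \<noteq> 0)"
  proof (cases m)
    case (Suc j)
    then have "\<not> ?P j" using not_less_Least[of j ?P] unfolding m_def by simp
    then obtain k x where k: "k > j" "x \<in> defect_space T" "theta_coeff T k x \<noteq> 0" by blast
    have "\<not> m < k" using m(1) k(2,3) by blast
    then have "k = m" using k(1) Suc by simp
    then show ?thesis using k by blast
  qed simp
  moreover have "characteristic_function T z x = (\<Sum>k\<le>m. z ^ k *\<^sub>C theta_coeff T k x)"
    if "z \<in> ball 0 1" "x \<in> defect_space T" for z x
  proof -
    have "z ^ k *\<^sub>C theta_coeff T k x = z ^ k *\<^sub>C (if k \<le> m then theta_coeff T k x else 0)" for k
      using m(1) that(2) by simp
    then have "(\<lambda>k. z ^ k *\<^sub>C theta_coeff T k x) sums (\<Sum>k\<le>m. z ^ k *\<^sub>C theta_coeff T k x)"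
      using sums_truncated[of z m "\<lambda>k. theta_coeff T k x"] by presburger
    then show ?thesis
      using characteristic_function_sums[OF assms(1), of z x] that(1) by (auto intro: sums_unique2)
  qed
  ultimately have "operator_poly_of_degree (defect_space T) (defect_space (adj T)) (characteristic_function T) m"
    unfolding operator_poly_of_degree_def
    by (intro exI[of _ "theta_coeff T"] conjI allI impI ballI theta_coeff_bounded[OF assms(1)])
  then show ?thesis using that m(2) by blast
qed

section \<open>Unitary parts\<close>

text \<open>A contraction satisfies \<open>T\<^sup>*T x = x\<close> wherever \<open>T\<close> preserves the norm, because the defect operator
  vanishes there. Hence \<open>T\<^sup>*\<close> inverts \<open>T\<close> on \<open>K\<close>, and \<open>K\<close> is invariant under both. Stating the
  conclusion for \<open>T\<close> and \<open>T\<^sup>*\<close> allows starting from either of them.\<close>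

lemma unitary_subspace_reduces:
  assumes T: "contraction T" and K: "closed_csubspace K" "T ` K = K" "\<And>x. x \<in> K \<Longrightarrow> norm (T x) = norm x"
  shows "reducing_subspace UNIV T K \<and> unitary_on K T \<and>
    reducing_subspace UNIV (adj T) K \<and> unitary_on K (adj T)"
proof -
  note T' = adj_contraction[OF T]
  have inv: "adj T (T x) = x" if "x \<in> K" for x
    using K(3)[OF that] defect2_eq_0_iff[OF T, of x] by (simp add: defect2_def)
  have inK: "T x \<in> K" if "x \<in> K" for x
    using imageI[OF that, of T] unfolding K(2) .
  have adjK: "adj T x \<in> K \<and> norm (adj T x) = norm x \<and> T (adj T x) = x" if "x \<in> K" for x
  proof -
    from \<open>x \<in> K\<close> have "x \<in> T ` K" unfolding K(2) .
    then obtain y where "x = T y" "y \<in> K" by (rule imageE)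
    then show ?thesis using inv K(3) by simp
  qed
  have "adj T ` K = K"
  proof
    show "adj T ` K \<subseteq> K" using adjK by blast
    show "K \<subseteq> adj T ` K"
    proof
      fix x assume "x \<in> K"
      then show "x \<in> adj T ` K" using inv[of x] inK[of x] by (metis imageI)
    qed
  qed
  moreover have "T \<in> bounded_ops K K"
    by (rule bounded_ops_codomain[OF bounded_ops_restrict[OF T_op[OF T] subset_UNIV] inK])
  moreover have "adj T \<in> bounded_ops K K"
    using adjK by (intro bounded_ops_codomain[OF bounded_ops_restrict[OF T_op[OF T'] subset_UNIV]]) auto
  ultimately show ?thesis
    using K inK adjK
    by (auto simp: reducing_subspace_def unitary_on_def isometry_on_def adj_adj[OF T_op[OF T]])
qed

lemma unitary_restriction_trivial:
  assumes T: "contraction T" and cnu: "completely_nonunitary_on UNIV T"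
    and K: "closed_csubspace K" and A: "A = T \<or> A = adj T" and U: "unitary_on K A"
  shows "K = {0}"
proof -
  have AK: "A ` K = K" "\<And>x. x \<in> K \<Longrightarrow> norm (A x) = norm x"
    using U by (auto simp: unitary_on_def isometry_on_def)
  have "reducing_subspace UNIV T K \<and> unitary_on K T"
    using A unitary_subspace_reduces[OF T K] AK
      unitary_subspace_reduces[OF adj_contraction[OF T] K] adj_adj[OF T_op[OF T]] by auto
  then show ?thesis using cnu by (auto simp: completely_nonunitary_on_def)
qed

text \<open>A unitary part of a restriction of \<open>T\<close> or \<open>T\<^sup>*\<close> is a subspace mapped isometrically onto itself,
  so it would be a unitary part of \<open>T\<close>. This is where the purity of both isometries in the
  representation comes from.\<close>

lemma completely_nonunitary_restriction:
  assumes "contraction T" "completely_nonunitary_on UNIV T" "A = T \<or> A = adj T"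
    and "\<And>x. x \<in> M \<Longrightarrow> V x = A x"
  shows "completely_nonunitary_on M V"
  unfolding completely_nonunitary_on_def
proof
  assume "\<exists>K. K \<noteq> {0} \<and> reducing_subspace M V K \<and> unitary_on K V"
  then obtain K where K: "K \<noteq> {0}" "closed_csubspace K" "K \<subseteq> M" "unitary_on K V"
    by (auto simp: reducing_subspace_def)
  then have eq: "V x = A x" if "x \<in> K" for x using assms(4) that by blast
  have "V \<in> bounded_ops K K" "\<And>x. x \<in> K \<Longrightarrow> norm (V x) = norm x" "V ` K = K"
    using K(4) by (auto simp: unitary_on_def isometry_on_def)
  then have "unitary_on K A"
    using bounded_ops_cong[OF K(2), of V K A] eq image_cong[OF refl, of K V A]
    by (simp add: unitary_on_def isometry_on_def)
  then show False using unitary_restriction_trivial[OF assms(1,2) K(2) assms(3)] K(1) by blast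
qed

section \<open>The triangular representation\<close>

text \<open>The vectors whose orbit under \<open>T\<close> is never shortened from time \<open>n\<close> on. For \<open>n = 0\<close> this is the largest
  invariant subspace on which \<open>T\<close> is isometric.\<close>

definition late_isometric :: "('a::complex_hilbert \<Rightarrow> 'a) \<Rightarrow> nat \<Rightarrow> 'a set" where
  "late_isometric T n = {x. \<forall>k\<ge>n. defect2 T ((T ^^ k) x) = 0}"

lemma late_isometric_subspace:
  assumes T: "contraction T"
  shows "closed_csubspace (late_isometric T n)"
proof (rule closed_csubspaceI)
  have bl: "bounded_linear (\<lambda>x. defect2 T ((T ^^ k) x))" for k
    by (rule bounded_linear_compose[OF bounded_linear_defect2[OF T]
        contraction_linear[OF contraction_funpow[OF T]]])
  note l = bounded_linear.linear[OF bl]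
  show "0 \<in> late_isometric T n" by (simp add: late_isometric_def linear_0[OF l])
  show "x + y \<in> late_isometric T n" if "x \<in> late_isometric T n" "y \<in> late_isometric T n" for x y
    using that by (simp add: late_isometric_def linear_add[OF l])
  show "c *\<^sub>C x \<in> late_isometric T n" if "x \<in> late_isometric T n" for c x
  proof -
    have "(T ^^ k) (c *\<^sub>C x) = c *\<^sub>C (T ^^ k) x" for k
      using bounded_opsD(3)[OF T_op[OF contraction_funpow[OF T]]] by simp
    then show ?thesis
      using that by (simp add: late_isometric_def defect2_eq_0_iff[OF T] norm_scaleC
          bounded_opsD(3)[OF T_op[OF T]])
  qed
  have "late_isometric T n = (\<Inter>k\<in>{n..}. (\<lambda>x. defect2 T ((T ^^ k) x)) -` {0})"
    by (auto simp: late_isometric_def)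
  moreover have "closed ((\<lambda>x. defect2 T ((T ^^ k) x)) -` {0})" for k
    by (intro closed_vimage linear_continuous_on bl closed_singleton)
  ultimately show "closed (late_isometric T n)" by (metis closed_INT)
qed

lemma late_isometric_mono: "m \<le> n \<Longrightarrow> late_isometric T m \<subseteq> late_isometric T n"
  by (auto simp: late_isometric_def)

lemma late_isometric_shift: "x \<in> late_isometric T (n + j) \<Longrightarrow> (T ^^ j) x \<in> late_isometric T n"
  by (auto simp: late_isometric_def funpow_add[unfolded fun_eq_iff o_def, rule_format, symmetric])

lemma orth_invariant_adj:
  assumes "contraction T" "\<And>x. x \<in> M \<Longrightarrow> T x \<in> M" "y \<in> orth M"
  shows "adj T y \<in> orth M"
  using assms(2,3) by (auto simp: orth_def cinner_adj'[OF T_op[OF assms(1)]])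

text \<open>The diagonal entries are the restriction of \<open>T\<close> to \<open>H1\<close> and its compressions to \<open>H0\<close> and \<open>Hm\<close>; the
  adjoint of the last is the restriction of \<open>T\<^sup>*\<close> to \<open>Hm\<close>. The condition on the characteristic
  function enters as the isometry of \<open>T\<^sup>*\<close> on \<open>Hm\<close>.\<close>

lemma rep_if_theta_vanishes:
  assumes T: "contraction T" and cnu: "completely_nonunitary_on UNIV T"
    and van: "theta_vanishes_from T n"
  obtains H1 H0 Hm S N C where "shift_nilpotent_coshift_rep T H1 H0 Hm S N C"
    "nilpotency_order H0 N \<le> n"
proof -
  note T' = adj_contraction[OF T]
  note Top = T_op[OF T]
  note Tlin = bounded_linear.linear[OF contraction_linear[OF T]]
  define H1 where "H1 = late_isometric T 0"
  define L where "L = late_isometric T n"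
  define Hm where "Hm = orth L"
  define H0 where "H0 = L \<inter> orth H1"
  have cs1: "closed_csubspace H1" and csL: "closed_csubspace L"
    unfolding H1_def L_def by (rule late_isometric_subspace[OF T])+
  have csm: "closed_csubspace Hm" unfolding Hm_def by (rule closed_csubspace_orth)
  have cs0: "closed_csubspace H0"
    unfolding H0_def by (intro closed_csubspace_Int csL closed_csubspace_orth)
  have H1L: "H1 \<subseteq> L" unfolding H1_def L_def by (rule late_isometric_mono) simp
  have decomp: "x = proj H1 x + proj H0 x + proj Hm x" for x
  proof -
    have m: "x - proj L x \<in> Hm" "proj L x \<in> L"
      unfolding Hm_def by (intro proj_orth proj_in csL)+
    have pm: "proj Hm x = x - proj L x"
    proof (rule proj_eqI[OF csm m(1)])
      show "x - (x - proj L x) \<in> orth Hm" using m(2) by (simp add: Hm_def orth_orth[OF csL])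
    qed
    have p1: "proj H1 x \<in> H1" by (rule proj_in[OF cs1])
    have "proj H0 x = proj L x - proj H1 x"
    proof (rule proj_eqI[OF cs0])
      have "x - proj L x \<in> orth H1" using m(1) H1L by (auto simp: Hm_def orth_def)
      then have "(x - proj H1 x) - (x - proj L x) \<in> orth H1"
        by (rule closed_csubspaceD(3)[OF closed_csubspace_orth proj_orth[OF cs1]])
      then show "proj L x - proj H1 x \<in> H0"
        using closed_csubspaceD(3)[OF csL m(2), of "proj H1 x"] p1 H1L by (auto simp: H0_def)
      have "cinner (proj H1 x) b = 0" "cinner (x - proj L x) b = 0" if "b \<in> H0" for b
        using that p1 m(1) by (auto simp: H0_def Hm_def orth_def cinner_commute_0)
      then show "x - (proj L x - proj H1 x) \<in> orth H0"
        by (auto simp: orth_def cinner_diff_left)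
    qed
    then show ?thesis using pm by simp
  qed
  have orth10: "cinner x y = 0" if "x \<in> H1" "y \<in> H0" for x y
    using that by (auto simp: H0_def orth_def cinner_commute_0)
  have orth1m: "cinner x y = 0" if "x \<in> H1" "y \<in> Hm" for x y
    using that H1L by (auto simp: Hm_def orth_def cinner_commute_0)
  have orth0m: "cinner x y = 0" if "x \<in> H0" "y \<in> Hm" for x y
    using that by (auto simp: H0_def Hm_def orth_def cinner_commute_0)
  have od: "orthogonal_decomposition H1 H0 Hm"
    unfolding orthogonal_decomposition_def
  proof (intro conjI ballI allI)
    show "\<exists>a\<in>H1. \<exists>b\<in>H0. \<exists>c\<in>Hm. x = a + b + c" for x
      by (rule bexI[of _ "proj H1 x"], rule bexI[of _ "proj H0 x"], rule bexI[of _ "proj Hm x"])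
        (intro decomp proj_in cs1 cs0 csm)+
  qed (auto intro: cs1 cs0 csm orth10 orth1m orth0m)
  have T1: "T x \<in> H1" if "x \<in> H1" for x
    using late_isometric_shift[of x T 0 1] late_isometric_mono[of 0 1 T] that by (auto simp: H1_def)
  have TL: "T x \<in> L" if "x \<in> L" for x
    using late_isometric_shift[of x T n 1] late_isometric_mono[of n "n+1" T] that by (auto simp: L_def)
  have TLn: "(T ^^ n) x \<in> H1" if "x \<in> L" for x
    using late_isometric_shift[of x T 0 n] that by (simp add: L_def H1_def)
  define N where "N = (\<lambda>x. proj H0 (T x))"
  define C where "C = (\<lambda>x. proj Hm (T x))"
  have comp: "(\<lambda>x. proj M (T x)) \<in> bounded_ops K M" if "closed_csubspace M" for M K
    by (rule bounded_ops_restrict[OF bounded_ops_compose[OF Top proj_bounded_op[OF that]] subset_UNIV])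
  have split: "T b = proj H1 (T b) + N b" if "b \<in> L" for b
  proof -
    have "proj Hm (T b) = 0"
      using TL[OF that] by (intro proj_eqI[OF csm])
        (auto simp: closed_csubspaceD(1)[OF closed_csubspace_orth] Hm_def orth_orth[OF csL])
    then show ?thesis using decomp[of "T b"] by (simp add: N_def)
  qed
  have S: "pure_isometry_on H1 T"
    unfolding pure_isometry_on_def isometry_on_def
  proof (intro conjI ballI)
    show "T \<in> bounded_ops H1 H1"
      by (rule bounded_ops_codomain[OF bounded_ops_restrict[OF Top subset_UNIV] T1])
    show "norm (T x) = norm x" if "x \<in> H1" for x
    proof -
      have "defect2 T ((T ^^ 0) x) = 0" using that unfolding H1_def late_isometric_def by blast
      then show ?thesis by (simp add: defect2_eq_0_iff[OF T])
    qed
    show "completely_nonunitary_on H1 T"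
      by (rule completely_nonunitary_restriction[OF T cnu, of T]) auto
  qed
  \<comment> \<open>Modulo the invariant subspace \<open>H1\<close>, the powers of \<open>N\<close> are those of \<open>T\<close>.\<close>
  have Nk: "(N ^^ k) b \<in> L \<and> (T ^^ k) b - (N ^^ k) b \<in> H1" if "b \<in> H0" for k b
  proof (induction k)
    case 0
    then show ?case using that closed_csubspaceD(1)[OF cs1] by (simp add: H0_def)
  next
    case (Suc k)
    let ?c = "(N ^^ k) b"
    have "T ((T ^^ k) b - ?c) + proj H1 (T ?c) \<in> H1"
      using Suc by (intro closed_csubspaceD(2)[OF cs1] T1 proj_in[OF cs1]) auto
    moreover have "T ((T ^^ k) b - ?c) + proj H1 (T ?c) = T ((T ^^ k) b) - N ?c"
      using split[of ?c] Suc by (simp add: linear_diff[OF Tlin] algebra_simps)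
    moreover have "N ?c \<in> L" using proj_in[OF cs0] by (auto simp: N_def H0_def)
    ultimately show ?case by simp
  qed
  have N0: "(N ^^ n) b = 0" if "b \<in> H0" for b
  proof -
    have "(N ^^ n) b \<in> H1"
      using closed_csubspaceD(3)[OF cs1 TLn[of b] conjunct2[OF Nk[OF that, of n]]] that
      by (simp add: H0_def)
    moreover have "(N ^^ n) b \<in> H0"
    proof (cases n)
      case 0
      then show ?thesis using that by simp
    next
      case (Suc m)
      then show ?thesis by (simp add: N_def proj_in[OF cs0])
    qed
    ultimately show ?thesis using orth10[of "(N ^^ n) b" "(N ^^ n) b"] by simp
  qed
  have nil: "nilpotent_on H0 N"
    unfolding nilpotent_on_def using comp[OF cs0, of H0] N0 by (auto simp: N_def)
  have adjm: "adj T x \<in> Hm" if "x \<in> Hm" for x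
    using that orth_invariant_adj[OF T TL] unfolding Hm_def by blast
  have adjC: "adj_on Hm C x = adj T x" if "x \<in> Hm" for x
  proof (rule adj_on_eqI[OF csm adjm[OF that]])
    fix u
    show "cinner (C u) x = cinner u (adj T x)"
      by (simp add: C_def cinner_proj_left[OF csm that] cinner_adj[OF Top])
  qed
  have "norm (adj T x) = norm x" if "x \<in> Hm" for x
  proof -
    \<comment> \<open>The self-adjoint \<open>I - TT\<^sup>*\<close> has range in \<open>L\<close>, so it vanishes on the complement \<open>Hm\<close>.\<close>
    have "defect2 (adj T) y \<in> L" for y
      using van by (simp add: L_def late_isometric_def theta_vanishes_from_def)
    then have "cinner (defect2 (adj T) x) y = 0" for y
      using that by (auto simp: defect2_selfadjoint[OF T'] Hm_def orth_def)
    then have "defect2 (adj T) x = 0" using cinner_self_eq_0_iff by blast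
    then show ?thesis by (simp add: defect2_eq_0_iff[OF T'])
  qed
  moreover have "adj_on Hm C \<in> bounded_ops Hm Hm"
  proof -
    have "adj T \<in> bounded_ops Hm Hm"
      by (rule bounded_ops_codomain[OF bounded_ops_restrict[OF T_op[OF T'] subset_UNIV] adjm])
    then show ?thesis by (rule bounded_ops_cong[OF csm]) (rule adjC)
  qed
  ultimately have pc: "pure_coisometry_on Hm C"
    unfolding pure_coisometry_on_def pure_isometry_on_def isometry_on_def
    using comp[OF csm, of Hm, folded C_def]
      completely_nonunitary_restriction[OF T cnu, of "adj T" Hm "adj_on Hm C"]
    by (simp add: adjC)
  have "upper_triangular_rep T H1 H0 Hm T N C"
    unfolding upper_triangular_rep_def
  proof (intro bexI ballI)
    show "T (a + b + c) = (T a + proj H1 (T b) + proj H1 (T c)) + (N b + proj H0 (T c)) + C c"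
      if "b \<in> H0" for a b c
    proof -
      have "b \<in> L" using that by (simp add: H0_def)
      have "T (a + b + c) = T a + (proj H1 (T b) + N b)
          + (proj H1 (T c) + proj H0 (T c) + proj Hm (T c))"
        by (simp only: linear_add[OF Tlin] split[OF \<open>b \<in> L\<close>, symmetric] decomp[symmetric])
      then show ?thesis by (simp add: C_def add_ac)
    qed
  qed (intro comp cs1 cs0)+
  then have "shift_nilpotent_coshift_rep T H1 H0 Hm T N C"
    unfolding shift_nilpotent_coshift_rep_def using od S nil pc by blast
  moreover have "nilpotency_order H0 N \<le> n"
    unfolding nilpotency_order_def using N0 by (intro Least_le) blast
  ultimately show ?thesis using that by blast
qed

text \<open>The operator \<open>I - TT\<^sup>*\<close> vanishes on \<open>Hm\<close>, where \<open>T\<^sup>*\<close> is the adjoint of the co-isometry \<open>C\<close>, so its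
  range lies in \<open>H1 \<oplus> H0\<close>. A power of \<open>T\<close> that is at least the order of \<open>N\<close> moves this into \<open>H1\<close>,
  where \<open>T\<close> is isometric and \<open>I - T\<^sup>*T\<close> vanishes.\<close>

lemma theta_vanishes_if_rep:
  assumes T: "contraction T" and rep: "shift_nilpotent_coshift_rep T H1 H0 Hm S N C"
  shows "theta_vanishes_from T (nilpotency_order H0 N)"
proof -
  note T' = adj_contraction[OF T]
  note Top = T_op[OF T]
  note Tlin = bounded_linear.linear[OF contraction_linear[OF T]]
  note Tklin = bounded_linear.linear[OF contraction_linear[OF contraction_funpow[OF T]]]
  have od: "orthogonal_decomposition H1 H0 Hm" and S: "pure_isometry_on H1 S"
    and N: "nilpotent_on H0 N" and C: "pure_coisometry_on Hm C"
    and ut: "upper_triangular_rep T H1 H0 Hm S N C"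
    using rep by (auto simp: shift_nilpotent_coshift_rep_def)
  have cs: "closed_csubspace H1" "closed_csubspace H0" "closed_csubspace Hm"
    and orth: "\<And>x y. x \<in> H1 \<Longrightarrow> y \<in> H0 \<Longrightarrow> cinner x y = 0"
      "\<And>x y. x \<in> H1 \<Longrightarrow> y \<in> Hm \<Longrightarrow> cinner x y = 0"
      "\<And>x y. x \<in> H0 \<Longrightarrow> y \<in> Hm \<Longrightarrow> cinner x y = 0"
    and dec: "\<And>x. \<exists>a\<in>H1. \<exists>b\<in>H0. \<exists>c\<in>Hm. x = a + b + c"
    using od by (auto simp: orthogonal_decomposition_def)
  note z = closed_csubspaceD(1)[OF cs(1)] closed_csubspaceD(1)[OF cs(2)] closed_csubspaceD(1)[OF cs(3)]
  obtain X Y Z where XYZ: "X \<in> bounded_ops H0 H1" "Y \<in> bounded_ops Hm H1" "Z \<in> bounded_ops Hm H0"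
    and Teq: "\<And>a b c. a \<in> H1 \<Longrightarrow> b \<in> H0 \<Longrightarrow> c \<in> Hm \<Longrightarrow>
        T (a + b + c) = (S a + X b + Y c) + (N b + Z c) + C c"
    using ut unfolding upper_triangular_rep_def by blast
  have zero: "A 0 = 0" if "A \<in> bounded_ops M K" "0 \<in> M" for A :: "'a \<Rightarrow> 'a" and M K
    using bounded_opsD(2)[OF that(1) that(2) that(2)] by simp
  have Nop: "N \<in> bounded_ops H0 H0" and Cop: "C \<in> bounded_ops Hm Hm"
    and Sop: "S \<in> bounded_ops H1 H1" and Siso: "\<And>x. x \<in> H1 \<Longrightarrow> norm (S x) = norm x"
    and Ciso: "\<And>x. x \<in> Hm \<Longrightarrow> norm (adj_on Hm C x) = norm x"
    using S N C by (auto simp: nilpotent_on_def pure_coisometry_on_def pure_isometry_on_def isometry_on_def)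
  note zeros = zero[OF XYZ(1) z(2)] zero[OF XYZ(2) z(3)] zero[OF XYZ(3) z(3)] zero[OF Nop z(2)]
    zero[OF Cop z(3)] zero[OF Sop z(1)]
  have Ta: "T a = S a" if "a \<in> H1" for a using Teq[OF that z(2,3)] zeros by simp
  have Tb: "T b = X b + N b" if "b \<in> H0" for b using Teq[OF z(1) that z(3)] zeros by simp
  have Tc: "T c = Y c + Z c + C c" if "c \<in> Hm" for c using Teq[OF z(1,2) that] zeros by simp
  have T1: "T a \<in> H1" if "a \<in> H1" for a using Ta bounded_opsD(1)[OF Sop] that by simp
  have T1k: "(T ^^ k) a \<in> H1" if "a \<in> H1" for a k by (induction k) (auto simp: that T1)
  have defect_H1: "defect2 T a = 0" if "a \<in> H1" for a
    using Ta Siso that by (simp add: defect2_eq_0_iff[OF T])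
  have Nk: "(N ^^ k) b \<in> H0 \<and> (T ^^ k) b - (N ^^ k) b \<in> H1" if "b \<in> H0" for k b
  proof (induction k)
    case (Suc k)
    let ?c = "(N ^^ k) b"
    have "T ((T ^^ k) b - ?c) + X ?c \<in> H1"
      using Suc by (intro closed_csubspaceD(2)[OF cs(1)] T1 bounded_opsD(1)[OF XYZ(1)]) auto
    moreover have "T ((T ^^ k) b - ?c) + X ?c = T ((T ^^ k) b) - N ?c"
      using Tb[of ?c] Suc by (simp add: linear_diff[OF Tlin] algebra_simps)
    ultimately show ?case using Suc bounded_opsD(1)[OF Nop] by simp
  qed (use that z in auto)
  define p where "p = nilpotency_order H0 N"
  have Np: "(N ^^ p) b = 0" if "b \<in> H0" for b
  proof -
    have "\<exists>p. \<forall>x\<in>H0. (N ^^ p) x = 0" using N by (auto simp: nilpotent_on_def)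
    from LeastI_ex[OF this] show ?thesis using that unfolding p_def nilpotency_order_def by blast
  qed
  have T0p: "(T ^^ p) b \<in> H1" if "b \<in> H0" for b using Nk[OF that, of p] Np[OF that] by simp
  have defect_Hm: "defect2 (adj T) c = 0" if "c \<in> Hm" for c
  proof -
    have adjc: "adj T c \<in> Hm"
    proof -
      \<comment> \<open>Since \<open>T\<close> maps \<open>H1\<close> and \<open>H0\<close> into the complement of \<open>Hm\<close>, the first two components of
        \<open>T\<^sup>* c\<close> are orthogonal to \<open>T\<^sup>* c\<close>.\<close>
      obtain a b d where abd: "a \<in> H1" "b \<in> H0" "d \<in> Hm" "adj T c = a + b + d" using dec by metis
      have "cinner a (adj T c) = 0"
        using orth(2)[OF T1[OF abd(1)] that] by (simp add: cinner_adj[OF Top, symmetric])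
      then have "a = 0" using orth abd by (simp add: cinner_add_right)
      have "cinner b (adj T c) = 0"
        using orth that bounded_opsD(1)[OF XYZ(1) abd(2)] bounded_opsD(1)[OF Nop abd(2)]
        by (simp add: cinner_adj[OF Top, symmetric] Tb[OF abd(2)] cinner_add_left)
      then have "b = 0" using orth abd \<open>a = 0\<close> by (simp add: cinner_add_right)
      then show ?thesis using abd \<open>a = 0\<close> by simp
    qed
    have "adj_on Hm C c = adj T c"
    proof (rule adj_on_eqI[OF cs(3) adjc])
      fix u assume u: "u \<in> Hm"
      show "cinner (C u) c = cinner u (adj T c)"
        using orth that bounded_opsD(1)[OF XYZ(2) u] bounded_opsD(1)[OF XYZ(3) u]
        by (simp add: cinner_adj[OF Top, symmetric] Tc[OF u] cinner_add_left)
    qed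
    then show ?thesis using Ciso[OF that] by (simp add: defect2_eq_0_iff[OF T'])
  qed
  have "defect2 T ((T ^^ k) (defect2 (adj T) y)) = 0" if "p \<le> k" for k y
  proof -
    obtain a b c where abc: "a \<in> H1" "b \<in> H0" "c \<in> Hm" "defect2 (adj T) y = a + b + c"
      using dec by metis
    have "cinner (defect2 (adj T) y) c = 0"
      using defect_Hm[OF abc(3)] by (simp add: defect2_selfadjoint[OF T'])
    then have "c = 0" using orth abc by (simp add: cinner_add_left)
    have "(T ^^ p) (a + b) \<in> H1"
      using T1k[OF abc(1)] T0p[OF abc(2)] closed_csubspaceD(2)[OF cs(1)]
      by (simp add: linear_add[OF Tklin])
    then have "(T ^^ (k - p)) ((T ^^ p) (a + b)) \<in> H1" by (rule T1k)
    moreover have "(T ^^ (k - p)) ((T ^^ p) (a + b)) = (T ^^ k) (defect2 (adj T) y)"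
      using that abc(4) \<open>c = 0\<close> funpow_add[of "k - p" p T] by simp
    ultimately show ?thesis using defect_H1 by simp
  qed
  then show ?thesis by (simp add: theta_vanishes_from_def p_def)
qed

theorem corollary3p4:
  fixes T :: "'a::complex_hilbert \<Rightarrow> 'a"
  assumes "separable_space (euclidean :: 'a topology)"
    and "contraction T"
    and "completely_nonunitary_on UNIV T"
  shows "(operator_polynomial (defect_space T) (defect_space (adj T)) (characteristic_function T)
            \<longleftrightarrow> (\<exists>H1 H0 Hm S N C. shift_nilpotent_coshift_rep T H1 H0 Hm S N C)) \<and>
         (operator_polynomial (defect_space T) (defect_space (adj T)) (characteristic_function T)
            \<longrightarrow> operator_degree (defect_space T) (defect_space (adj T)) (characteristic_function T)
                  = (LEAST p. \<exists>H1 H0 Hm S N C.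
                       shift_nilpotent_coshift_rep T H1 H0 Hm S N C \<and> p = nilpotency_order H0 N))"
proof (intro conjI impI)
  note T = assms(2) and cnu = assms(3)
  let ?poly = "operator_poly_of_degree (defect_space T) (defect_space (adj T)) (characteristic_function T)"
  let ?rep = "shift_nilpotent_coshift_rep T"
  have rep_of_poly: "\<exists>H1 H0 Hm S N C. ?rep H1 H0 Hm S N C \<and> nilpotency_order H0 N \<le> n"
    if "?poly n" for n
    using rep_if_theta_vanishes[OF T cnu theta_vanishes_if_poly[OF T that]] by metis
  have poly_of_rep: "\<exists>m\<le>nilpotency_order H0 N. ?poly m" if "?rep H1 H0 Hm S N C" for H1 H0 Hm S N C
    using poly_if_theta_vanishes[OF T theta_vanishes_if_rep[OF T that]] by metis
  show "operator_polynomial (defect_space T) (defect_space (adj T)) (characteristic_function T)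
      \<longleftrightarrow> (\<exists>H1 H0 Hm S N C. ?rep H1 H0 Hm S N C)"
    unfolding operator_polynomial_def using rep_of_poly poly_of_rep by meson
  assume "operator_polynomial (defect_space T) (defect_space (adj T)) (characteristic_function T)"
  then obtain n where n: "?poly n" by (auto simp: operator_polynomial_def)
  have deg: "operator_degree (defect_space T) (defect_space (adj T)) (characteristic_function T) = n"
    unfolding operator_degree_def using n operator_poly_of_degree_unique by (intro the_equality) blast+
  have lower: "n \<le> nilpotency_order H0 N" if "?rep H1 H0 Hm S N C" for H1 H0 Hm S N C
    using poly_of_rep[OF that] operator_poly_of_degree_unique[OF n] by blast
  obtain H1 H0 Hm S N C where r: "?rep H1 H0 Hm S N C" "nilpotency_order H0 N \<le> n"
    using rep_of_poly[OF n] by blast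
  have "(LEAST p. \<exists>H1 H0 Hm S N C. ?rep H1 H0 Hm S N C \<and> p = nilpotency_order H0 N) = n"
  proof (rule Least_equality)
    show "\<exists>H1 H0 Hm S N C. ?rep H1 H0 Hm S N C \<and> n = nilpotency_order H0 N"
      using r lower[OF r(1)] le_antisym by blast
  qed (use lower in blast)
  then show "operator_degree (defect_space T) (defect_space (adj T)) (characteristic_function T)
      = (LEAST p. \<exists>H1 H0 Hm S N C. ?rep H1 H0 Hm S N C \<and> p = nilpotency_order H0 N)"
    by (simp add: deg)
qed

end
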